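(* Let $G$ be a connected simple graph with a finite vertex set $V$ and let $k=|V|$. Let $Q$ be the unique stationary measure for the meteor process on $G$ with $\sum_{x\in V}M^x_0=k$, and let $U_Q$ be the closure of the support of $Q$ in $[0,\infty)^V$. Let $U$ be the (closed) subset of $[0,\infty)^V$ consisting of all $\{a_x,x\in V\}$ such that $\sum_{x\in V}a_x=k$ and $a_x=0$ for at least one $x\in V$. Then $U_Q=U$.
   Context: Meteor process on a finite connected simple graph $G$ with vertex set $V$, in which every vertex $v$ has degree $d_v\ge 1$: let $N^v$, $v\in V$, be independent Poisson processes with intensity 1, independent of the initial masses $M^v_0\ge 0$. At each jump time $t$ of $N^v$, the mass at $v$ is distributed equally among the $d_v$ neighbors of $v$: $M^v_t=0$ and $M^x_t=M^x_{t-}+M^v_{t-}/d_v$ for every neighbor $x$ of $v$; the mass at a vertex does not change otherwise. Write $\mathcal{M}_t=\{M^v_t,v\in V\}$. The total mass is conserved. It is known that for total mass $\sum_{x\in V}M^x_0=k=|V|$ the process has a unique stationary distribution $Q$ (a probability measure on $[0,\infty)^V$). *)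

theory Defs
  imports "HOL-Probability.Probability" "Graph_Theory.Graph_Theory"
begin

section \<open>Poisson processes\<close>

text \<open>
  Time is the half-line of nonnegative reals inside \<^typ>\<open>real\<close>; the values of a process at negative
  times play no role.  As paths are almost surely nondecreasing, the truncated subtraction of
  natural numbers in the increments is the true one almost surely.
\<close>

definition poisson_process :: "'w measure \<Rightarrow> real \<Rightarrow> (real \<Rightarrow> 'w \<Rightarrow> nat) \<Rightarrow> bool" where
  "poisson_process P r N \<longleftrightarrow>
     (\<forall>t\<ge>0. N t \<in> P \<rightarrow>\<^sub>M count_space UNIV) \<and>
     (AE \<omega> in P. N 0 \<omega> = 0 \<and> mono_on {0..} (\<lambda>t. N t \<omega>) \<and>
        (\<forall>t\<ge>0. continuous (at_right t) (\<lambda>s. N s \<omega>))) \<and>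
     (\<forall>s t. 0 \<le> s \<longrightarrow> s < t \<longrightarrow>
        distr P (count_space UNIV) (\<lambda>\<omega>. N t \<omega> - N s \<omega>) =
        measure_pmf (poisson_pmf (r * (t - s)))) \<and>
     (\<forall>(n::nat) \<tau>. 0 \<le> \<tau> 0 \<longrightarrow> mono \<tau> \<longrightarrow>
        prob_space.indep_vars P (\<lambda>_. count_space UNIV)
          (\<lambda>i \<omega>. N (\<tau> (Suc i)) \<omega> - N (\<tau> i) \<omega>) {..<n})"

definition path :: "(real \<Rightarrow> 'w \<Rightarrow> nat) \<Rightarrow> 'w \<Rightarrow> real \<Rightarrow> nat" where
  "path N \<omega> = (\<lambda>t\<in>{0..}. N t \<omega>)"

abbreviation path_space :: "(real \<Rightarrow> nat) measure" where
  "path_space \<equiv> PiM {0..} (\<lambda>_. count_space UNIV)"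

definition left_limit :: "(real \<Rightarrow> 'b::t2_space) \<Rightarrow> real \<Rightarrow> 'b" where
  "left_limit f t = Lim (at_left t) f"

definition jump_time :: "(real \<Rightarrow> nat) \<Rightarrow> real \<Rightarrow> bool" where
  "jump_time n t \<longleftrightarrow> t > 0 \<and> n t \<noteq> left_limit n t"


section \<open>The meteor process\<close>

abbreviation degree :: "'v pair_pre_digraph \<Rightarrow> 'v \<Rightarrow> nat" where
  "degree G v \<equiv> out_degree (with_proj G) v"

text \<open>
  \<open>n v\<close> is the path of the Poisson process at \<open>v\<close>, and \<open>m t $ v\<close> is the mass at \<open>v\<close> at time \<open>t\<close>.
  The second conjunct says that a mass changes only when a meteor hits its vertex or a neighbor of
  its vertex.  It makes \<open>m\<close> locally constant between jumps, so the left limits in the first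
  conjunct exist.  Simultaneous jumps at different vertices, for which the first conjunct may be
  contradictory, have probability zero for independent Poisson processes.
\<close>

definition meteor_dynamics ::
  "'v::finite pair_pre_digraph \<Rightarrow> ('v \<Rightarrow> real \<Rightarrow> nat) \<Rightarrow> (real \<Rightarrow> real ^ 'v) \<Rightarrow> bool" where
  "meteor_dynamics G n m \<longleftrightarrow>
     (\<forall>t v. jump_time (n v) t \<longrightarrow>
        m t $ v = 0 \<and>
        (\<forall>x. (v, x) \<in> parcs G \<longrightarrow>
           m t $ x = left_limit m t $ x + left_limit m t $ v / real (degree G v))) \<and>
     (\<forall>x s t. 0 \<le> s \<longrightarrow> s \<le> t \<longrightarrow>
        (\<forall>u\<in>{s<..t}. \<forall>v. v = x \<or> (v, x) \<in> parcs G \<longrightarrow> \<not> jump_time (n v) u) \<longrightarrow>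
        m t $ x = m s $ x)"

definition meteor_process ::
  "'w measure \<Rightarrow> 'v::finite pair_pre_digraph \<Rightarrow> ('v \<Rightarrow> real \<Rightarrow> 'w \<Rightarrow> nat) \<Rightarrow>
   (real \<Rightarrow> 'w \<Rightarrow> real ^ 'v) \<Rightarrow> bool" where
  "meteor_process P G N M \<longleftrightarrow>
     prob_space P \<and>
     (\<forall>v. poisson_process P 1 (N v)) \<and>
     prob_space.indep_vars P (\<lambda>_. path_space) (\<lambda>v. path (N v)) UNIV \<and>
     prob_space.indep_set P
       (sets (vimage_algebra (space P) (M 0) borel))
       (sets (vimage_algebra (space P) (\<lambda>\<omega>. \<lambda>v\<in>UNIV. path (N v) \<omega>) (PiM UNIV (\<lambda>_. path_space)))) \<and>
     (\<forall>t\<ge>0. M t \<in> borel_measurable P) \<and>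
     (AE \<omega> in P. \<forall>x. 0 \<le> M 0 \<omega> $ x) \<and>
     (AE \<omega> in P. meteor_dynamics G (\<lambda>v t. N v t \<omega>) (\<lambda>t. M t \<omega>))"

text \<open>
  \<open>Q\<close> is stationary, as witnessed by a meteor process that starts from \<open>Q\<close>.  The law of a meteor
  process is determined by the law of its initial state, so nothing depends on the choice of the
  witness \<open>(P, N, M)\<close>.
\<close>

definition stationary_measure ::
  "'w measure \<Rightarrow> 'v::finite pair_pre_digraph \<Rightarrow> ('v \<Rightarrow> real \<Rightarrow> 'w \<Rightarrow> nat) \<Rightarrow>
   (real \<Rightarrow> 'w \<Rightarrow> real ^ 'v) \<Rightarrow> (real ^ 'v) measure \<Rightarrow> bool" where
  "stationary_measure P G N M Q \<longleftrightarrow>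
     meteor_process P G N M \<and> (\<forall>t\<ge>0. distr P borel (M t) = Q)"


section \<open>The support of a measure\<close>

definition measure_support :: "'a::topological_space measure \<Rightarrow> 'a set" where
  "measure_support Q = {x. \<forall>S. open S \<longrightarrow> x \<in> S \<longrightarrow> emeasure Q S > 0}"

end

theory Submission
  imports Defs
begin

text \<open>
  Let \<open>U\<close> be the set of nonnegative states of mass \<open>CARD('v)\<close> with at least one empty vertex.  Let
  \<open>hit E v\<close> be the linear map that redistributes the mass at \<open>v\<close> among its neighbors, and let \<open>run E w\<close>
  compose these maps along a word \<open>w\<close> of vertices.  All of them conserve the mass and do not increase
  the \<open>l1\<close> norm.

  \<^emph>\<open>The support lies in \<open>U\<close>.\<close>  A vertex that has just been hit is empty, and it stays empty until the
  next hit in the graph.  So once any hit has occurred, some vertex is always empty.  The probability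
  that there is no hit before time \<open>t\<close> is at most \<open>exp (- t)\<close>.  By stationarity this bounds the measure
  of the set of states without an empty vertex for every \<open>t\<close>, so that set is null
  (\<open>stationary_vacant_site\<close>).  As \<open>U\<close> is closed and has full measure, it contains the support.

  \<^emph>\<open>\<open>U\<close> lies in the support.\<close>  Every word \<open>w\<close> has a positive probability of being exactly the sequence of
  hits in a suitable time interval, one hit per unit of time, and this event is independent of the
  initial state (\<open>hit_sequence_prob\<close>).  There are only countably many words, so an open set has
  positive measure as soon as \<open>Q\<close>-almost every state can be moved into it by some word
  (\<open>stationary_support_run\<close>).  What remains is deterministic: from every state \<open>b\<close> of the right mass
  one can come arbitrarily close to every \<open>a\<close> in \<open>U\<close> (\<open>meteor_approximation\<close>).

  For this, run time backwards from \<open>a\<close>.  If \<open>z\<close> is empty in \<open>a\<close>, then \<open>a = hit E z a'\<close>, where \<open>a'\<close> arises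
  from \<open>a\<close> by pulling equal amounts of mass from the neighbors of \<open>z\<close> back to \<open>z\<close>.  The largest possible
  amount empties the neighbor that carries the least mass, so \<open>a'\<close> again has an empty vertex, and one
  can go on forever.  This gives words \<open>w\<close> of every length and states \<open>c\<close> with \<open>run E w c = a\<close>, and
  then \<open>run E w b\<close> is close to \<open>a\<close> provided that \<open>run E w\<close> contracts strongly on vectors of mass zero.
  Two facts ensure this.

  \<^item> A word that sweeps over all vertices sufficiently often contracts by a definite factor
    (\<open>uniform_contraction\<close>).  This is a coupling argument: follow two particles that are moved by the
    same hits.  Whenever one of them is hit while the other one rests, it steps toward
    the other with a probability that is bounded below.
  \<^item> The empty vertex of a backward orbit visits every vertex infinitely often (\<open>orbit_recurrent\<close>).
    Otherwise the masses at all vertices would converge, those at the vertices that are visited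
    infinitely often to \<open>0\<close>; but the total mass at the other vertices eventually only
    decreases, so mass would disappear.

  The backward orbit gets stuck at a state with two adjacent empty vertices.  Such states are
  avoided by starting from a state whose masses outside one empty vertex are linearly independent over
  the integers: backward steps preserve this property, which makes the minimal neighbor unique, and
  the states with this property are dense in \<open>U\<close> (\<open>generic_dense\<close>).
\<close>

section \<open>Redistribution of mass\<close>

definition mass :: "real ^ 'v::finite \<Rightarrow> real" where
  "mass a = (\<Sum>x\<in>UNIV. a $ x)"

definition l1 :: "real ^ 'v::finite \<Rightarrow> real" where
  "l1 a = (\<Sum>x\<in>UNIV. \<bar>a $ x\<bar>)"

text \<open>
  Written as a sum of what stays and what arrives, so that linearity and conservation of mass can be
  read off termwise.
\<close>
definition hit :: "('v::finite) rel \<Rightarrow> 'v \<Rightarrow> real ^ 'v \<Rightarrow> real ^ 'v" where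
  "hit E v a = (\<chi> x. (if x = v then 0 else a $ x) +
     (if (v, x) \<in> E then a $ v / real (card (E `` {v})) else 0))"

text \<open>The last letter of the word acts first, so words compose like functions.\<close>
abbreviation run :: "('v::finite) rel \<Rightarrow> 'v list \<Rightarrow> real ^ 'v \<Rightarrow> real ^ 'v" where
  "run E \<equiv> foldr (hit E)"

lemma mass_diff: "mass (a - b) = mass a - mass b"
  and mass_scaleR: "mass (c *\<^sub>R a) = c * mass a"
  by (simp_all add: mass_def sum_subtractf sum_distrib_left)

lemma l1_nonneg: "0 \<le> l1 a"
  by (simp add: l1_def sum_nonneg)

lemma l1_add: "l1 (a + b) \<le> l1 a + l1 b"
  by (simp add: l1_def sum.distrib[symmetric] sum_mono abs_triangle_ineq)

lemma l1_diff: "l1 (a - b) \<le> l1 a + l1 b"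
  by (simp add: l1_def sum.distrib[symmetric] sum_mono abs_triangle_ineq4)

lemma l1_scaleR: "l1 (c *\<^sub>R a) = \<bar>c\<bar> * l1 a"
  by (simp add: l1_def abs_mult sum_distrib_left)

lemma l1_0 [simp]: "l1 0 = 0"
  by (simp add: l1_def)

lemma l1_sum: "l1 (\<Sum>i\<in>I. f i) \<le> (\<Sum>i\<in>I. l1 (f i))"
proof (induction I rule: infinite_finite_induct)
  case (insert i I)
  then show ?case using l1_add[of "f i" "\<Sum>i\<in>I. f i"] by simp
qed simp_all

lemma abs_mass_le_l1: "\<bar>mass a\<bar> \<le> l1 a"
  by (simp add: mass_def l1_def sum_abs)

lemma l1_eq_mass: "(\<And>x. 0 \<le> a $ x) \<Longrightarrow> l1 a = mass a"
  by (simp add: mass_def l1_def)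

lemma l1_axis [simp]: "l1 (axis x 1) = 1"
proof -
  have "l1 (axis x 1) = (\<Sum>y\<in>UNIV. if y = x then 1 else 0)"
    unfolding l1_def by (rule sum.cong) (auto simp: axis_def)
  then show ?thesis by simp
qed

lemma norm_le_l1: "norm a \<le> l1 a"
  unfolding l1_def by (rule norm_le_l1_cart)

lemma linear_hit: "linear (hit E v)"
  by (rule linearI) (auto simp: hit_def vec_eq_iff add_divide_distrib algebra_simps)

lemma linear_run: "linear (run E w)"
proof (induction w)
  case Nil
  show ?case by (simp add: linear_iff)
next
  case (Cons v w)
  have "linear (hit E v \<circ> run E w)"
    by (rule linear_compose[OF Cons linear_hit])
  then show ?case by (simp add: comp_def linear_iff)
qed

lemma hit_idle: "a $ v = 0 \<Longrightarrow> hit E v a = a"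
  by (auto simp: hit_def vec_eq_iff)

lemma run_idle: "(\<And>v. v \<in> set w \<Longrightarrow> a $ v = 0) \<Longrightarrow> run E w a = a"
  by (induction w) (auto simp: hit_idle)

locale meteor_graph =
  fixes E :: "('v::finite) rel"
  assumes symmetric: "(x, y) \<in> E \<Longrightarrow> (y, x) \<in> E"
    and loopfree: "(x, x) \<notin> E"
    and connected: "(x, y) \<in> E\<^sup>*"
    and has_neighbor: "\<exists>y. (x, y) \<in> E"
begin

abbreviation deg :: "'v \<Rightarrow> real" where
  "deg v \<equiv> real (card (E `` {v}))"

lemma deg_pos: "deg v > 0"
  using has_neighbor[of v] by (auto simp: card_gt_0_iff)

lemma neighbors_nonempty: "E `` {v} \<noteq> {}"
  using has_neighbor[of v] by auto

lemma sum_neighbors: "(\<Sum>x\<in>UNIV. if (v, x) \<in> E then c else 0) = deg v * (c::real)"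
proof -
  have "(\<Sum>x\<in>UNIV. if (v, x) \<in> E then c else 0) = (\<Sum>x\<in>E `` {v}. c)"
    by (rule sum.mono_neutral_cong_right) auto
  then show ?thesis by simp
qed

lemma sum_except: "(\<Sum>x\<in>UNIV. if x = v then 0 else f x) = (\<Sum>x\<in>UNIV. f x) - (f (v :: 'v) :: real)"
proof -
  have "(\<Sum>x\<in>UNIV. if x = v then 0 else f x) + (\<Sum>x\<in>UNIV. if x = v then f x else 0) = (\<Sum>x\<in>UNIV. f x)"
    unfolding sum.distrib[symmetric] by (rule sum.cong) auto
  moreover have "(\<Sum>x\<in>UNIV. if x = v then f x else 0) = f v" by simp
  ultimately show ?thesis by linarith
qed

lemma mass_hit: "mass (hit E v a) = mass a"
  using deg_pos[of v] unfolding mass_def hit_def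
  by (simp add: sum.distrib sum_neighbors sum_except neighbors_nonempty)

lemma mass_run: "mass (run E w a) = mass a"
  by (induction w) (auto simp: mass_hit)

lemma l1_hit: "l1 (hit E v a) \<le> l1 a"
proof -
  have "l1 (hit E v a) \<le> (\<Sum>x\<in>UNIV. (if x = v then 0 else \<bar>a $ x\<bar>) +
      (if (v, x) \<in> E then \<bar>a $ v\<bar> / deg v else 0))"
    unfolding l1_def hit_def using deg_pos[of v]
    by (intro sum_mono) (auto intro: order_trans[OF abs_triangle_ineq])
  also have "\<dots> = l1 a"
    using deg_pos[of v] by (simp add: sum.distrib sum_neighbors sum_except l1_def neighbors_nonempty)
  finally show ?thesis .
qed

lemma l1_run: "l1 (run E w a) \<le> l1 a"
  by (induction w) (auto intro: order_trans[OF l1_hit])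

lemma hit_axis: "hit E v (axis v 1) = (1 / deg v) *\<^sub>R (\<Sum>x\<in>E `` {v}. axis x 1)"
proof -
  have "(\<Sum>y\<in>E `` {v}. axis y (1::real) $ x) = (if (v, x) \<in> E then 1 else 0)" for x
  proof -
    have "(\<Sum>y\<in>E `` {v}. axis y (1::real) $ x) = (\<Sum>y\<in>E `` {v}. if y = x then 1 else 0)"
      by (rule sum.cong) (auto simp: axis_def)
    then show ?thesis by simp
  qed
  then show ?thesis
    by (simp add: vec_eq_iff hit_def sum_component) (auto simp: axis_def)
qed

lemma hit_axis_other: "x \<noteq> v \<Longrightarrow> hit E v (axis x 1) = axis x 1"
  by (rule hit_idle) (simp add: axis_def)

section \<open>Contraction by coupling\<close>

text \<open>
  The word contains \<open>r\<close> disjoint blocks, each of which hits every vertex.  The block \<open>s\<close> at the end of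
  the word is the first one to act.
\<close>
primrec sweeps :: "nat \<Rightarrow> 'v list \<Rightarrow> bool" where
  "sweeps 0 w \<longleftrightarrow> True"
| "sweeps (Suc r) w \<longleftrightarrow> (\<exists>u s. w = u @ s \<and> set s = UNIV \<and> sweeps r u)"

lemma sweeps_append: "sweeps r u \<Longrightarrow> sweeps r (u @ s)"
proof (cases r)
  case (Suc q)
  assume "sweeps r u"
  then obtain u' s' where "u = u' @ s'" "set s' = UNIV" "sweeps q u'"
    using Suc by auto
  then have "u @ s = u' @ (s' @ s)" "set (s' @ s) = UNIV" by auto
  with \<open>sweeps q u'\<close> show ?thesis unfolding Suc sweeps.simps by blast
qed simp

lemma sweeps_mono: "r \<le> q \<Longrightarrow> sweeps q w \<Longrightarrow> sweeps r w"
proof (induction q rule: dec_induct)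
  case (step q)
  then show ?case by (auto simp: sweeps_append)
qed

text \<open>
  One step of the coupling argument: if one of the positions to which a particle can move gains \<open>q\<close>
  over the trivial bound, then by convexity the average over these positions keeps at least the share
  \<open>1 / CARD('v)\<close> of that gain.
\<close>
lemma l1_run_average:
  assumes "finite I" "i \<in> I" "card I \<le> CARD('v)"
    and le2: "\<And>j. j \<in> I \<Longrightarrow> l1 (f j) \<le> 2" and "l1 (run E w (f i)) \<le> 2 * (1 - q)" and "0 \<le> q"
  shows "l1 (run E w ((1 / real (card I)) *\<^sub>R (\<Sum>j\<in>I. f j))) \<le> 2 * (1 - q / real CARD('v))"
proof -
  have c: "real (card I) > 0" using assms(1,2) by (auto simp: card_gt_0_iff)
  have "run E w ((1 / real (card I)) *\<^sub>R (\<Sum>j\<in>I. f j)) = (1 / real (card I)) *\<^sub>R (\<Sum>j\<in>I. run E w (f j))"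
    by (simp add: linear_cmul[OF linear_run] linear_sum[OF linear_run])
  also have "l1 \<dots> \<le> (1 / real (card I)) * (\<Sum>j\<in>I. l1 (run E w (f j)))"
    unfolding l1_scaleR using l1_sum[of "\<lambda>j. run E w (f j)" I] c by (simp add: divide_right_mono)
  also have "(\<Sum>j\<in>I. l1 (run E w (f j))) \<le> (\<Sum>j\<in>I. 2 - (if j = i then 2 * q else 0))"
    using assms(5) by (intro sum_mono) (auto intro: order_trans[OF l1_run le2])
  also have "\<dots> = 2 * real (card I) - 2 * q"
    using assms(1,2) by (simp add: sum_subtractf)
  also have "(1 / real (card I)) * (2 * real (card I) - 2 * q) = 2 * (1 - q / real (card I))"
    using c by (simp add: field_simps)
  also have "\<dots> \<le> 2 * (1 - q / real CARD('v))"
    using c assms(3,6) by (simp add: frac_le)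
  finally show ?thesis using c by (simp add: divide_right_mono)
qed

lemma l1_axis_diff: "l1 (axis x 1 - axis y 1) \<le> 2"
  using l1_diff[of "axis x 1" "axis y 1"] by simp

text \<open>
  Put a unit mass on \<open>x\<close> and a negative unit mass on \<open>y\<close>, and wait for the first hit of one of the two
  during a sweep.  The other one rests meanwhile, so one of the positions to which the hit mass is
  spread is joined to the other mass by a walk that is shorter by one step.  After \<open>r\<close> sweeps a share
  of at least \<open>(1 / CARD('v)) ^ r\<close> has met and cancelled.
\<close>
lemma coupling:
  assumes "(x, y) \<in> E ^^ r" "sweeps r w"
  shows "l1 (run E w (axis x 1 - axis y 1)) \<le> 2 * (1 - (1 / real CARD('v)) ^ r)"
  using assms
proof (induction r arbitrary: x y w)
  case 0
  then show ?case by (simp add: linear_0[OF linear_run])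
next
  case (Suc r)
  let ?N = "real CARD('v)"
  show ?case
  proof (cases "x = y")
    case True
    have "(1 / ?N) ^ Suc r \<le> 1" by (rule power_le_one) auto
    then show ?thesis using True by (simp add: linear_0[OF linear_run] del: power_Suc)
  next
    case False
    obtain u s where w: "w = u @ s" "set s = UNIV" "sweeps r u"
      using Suc.prems(2) by auto
    have "\<exists>v\<in>set s. v \<in> {x, y}" using w(2) by auto
    then obtain s2 v s1 where s: "s = s2 @ v # s1" and v: "v \<in> {x, y}"
      and s1: "\<forall>z\<in>set s1. z \<notin> {x, y}"
      using split_list_last_prop[of s "\<lambda>v. v \<in> {x, y}"] by auto
    have "run E s1 (axis x 1 - axis y 1) = axis x 1 - axis y 1"
      using s1 by (intro run_idle) (auto simp: axis_def)
    then have runw: "run E w (axis x 1 - axis y 1) = run E (u @ s2) (hit E v (axis x 1 - axis y 1))"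
      by (simp add: w s)
    have sw: "sweeps r (u @ s2)" by (rule sweeps_append[OF w(3)])
    have q: "0 \<le> (1 / ?N) ^ r" by simp
    show ?thesis
    proof (cases "v = x")
      case True
      obtain x' where x': "(x, x') \<in> E" "(x', y) \<in> E ^^ r"
        using relpow_Suc_D2[OF Suc.prems(1)] by auto
      have "hit E v (axis x 1 - axis y 1) =
          (1 / deg x) *\<^sub>R (\<Sum>z\<in>E `` {x}. axis z 1 - axis y 1)"
        using False True deg_pos[of x]
        by (simp add: linear_diff[OF linear_hit] hit_axis hit_axis_other sum_subtractf
            scaleR_right_diff_distrib sum_constant_scaleR neighbors_nonempty del: sum_constant)
      moreover have "l1 (run E (u @ s2) ((1 / deg x) *\<^sub>R (\<Sum>z\<in>E `` {x}. axis z 1 - axis y 1))) \<le>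
          2 * (1 - (1 / ?N) ^ r / ?N)"
        by (rule l1_run_average[where i = x'])
          (use x'(1) Suc.IH[OF x'(2) sw] in \<open>auto simp: card_mono l1_axis_diff\<close>)
      ultimately show ?thesis unfolding runw by simp
    next
      case vx: False
      then have vy: "v = y" using v by simp
      obtain y' where y': "(x, y') \<in> E ^^ r" "(y', y) \<in> E"
        using Suc.prems(1) by auto
      have "hit E v (axis x 1 - axis y 1) =
          (1 / deg y) *\<^sub>R (\<Sum>z\<in>E `` {y}. axis x 1 - axis z 1)"
        using False vy deg_pos[of y]
        by (simp add: linear_diff[OF linear_hit] hit_axis hit_axis_other sum_subtractf
            scaleR_right_diff_distrib sum_constant_scaleR neighbors_nonempty del: sum_constant)
      moreover have "l1 (run E (u @ s2) ((1 / deg y) *\<^sub>R (\<Sum>z\<in>E `` {y}. axis x 1 - axis z 1))) \<le>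
          2 * (1 - (1 / ?N) ^ r / ?N)"
        by (rule l1_run_average[where i = y'])
          (use symmetric[OF y'(2)] Suc.IH[OF y'(1) sw] in \<open>auto simp: card_mono l1_axis_diff\<close>)
      ultimately show ?thesis unfolding runw by simp
    qed
  qed
qed

text \<open>
  A vector of mass zero is a mixture of differences of unit masses: match its positive part with its
  negative part by the product coupling.
\<close>
lemma uniform_contraction:
  obtains R and \<rho> :: real where "0 \<le> \<rho>" "\<rho> < 1"
    and "\<And>w d. sweeps R w \<Longrightarrow> mass d = 0 \<Longrightarrow> l1 (run E w d) \<le> \<rho> * l1 d"
proof -
  have "\<forall>p. \<exists>r. p \<in> E ^^ r"
    using connected by (auto simp: rtrancl_is_UN_relpow)
  then obtain r where r: "\<And>p. p \<in> E ^^ r p" by metis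
  define R where "R = Max (range r)"
  have R: "r p \<le> R" for p unfolding R_def by (rule Max_ge) auto
  define \<rho> where "\<rho> = 1 - (1 / real CARD('v)) ^ R"
  have pair: "l1 (run E w (axis x 1 - axis y 1)) \<le> 2 * \<rho>" if "sweeps R w" for w x y
  proof -
    have "l1 (run E w (axis x 1 - axis y 1)) \<le> 2 * (1 - (1 / real CARD('v)) ^ r (x, y))"
      by (rule coupling[OF r sweeps_mono[OF R that]])
    also have "\<dots> \<le> 2 * \<rho>"
      unfolding \<rho>_def using power_decreasing[OF R[of "(x, y)"], of "1 / real CARD('v)"] by simp
    finally show ?thesis .
  qed
  show ?thesis
  proof (rule that[of \<rho> R])
    show "0 \<le> \<rho>" unfolding \<rho>_def by (simp add: power_le_one)
    show "\<rho> < 1" unfolding \<rho>_def by simp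
    fix w and d :: "real ^ 'v"
    assume w: "sweeps R w" and d: "mass d = 0"
    define p where "p x = max 0 (d $ x)" for x
    define q where "q x = max 0 (- d $ x)" for x
    have pq: "0 \<le> p x" "0 \<le> q x" "d $ x = p x - q x" "\<bar>d $ x\<bar> = p x + q x" for x
      by (auto simp: p_def q_def)
    define s where "s = (\<Sum>x\<in>UNIV. p x)"
    have sq: "(\<Sum>x\<in>UNIV. q x) = s"
      using d unfolding mass_def s_def pq(3) by (simp add: sum_subtractf)
    have ld: "l1 d = 2 * s"
      unfolding l1_def pq(4) using sq by (simp add: sum.distrib s_def)
    have s0: "0 \<le> s" unfolding s_def by (simp add: sum_nonneg pq)
    have d': "d = (\<Sum>x\<in>UNIV. p x *\<^sub>R axis x 1) - (\<Sum>x\<in>UNIV. q x *\<^sub>R axis x 1)"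
      by (auto simp: vec_eq_iff sum_component pq(3) axis_def if_distrib[of "\<lambda>t. _ * t"] cong: if_cong)
    have "s *\<^sub>R d = (\<Sum>x\<in>UNIV. \<Sum>y\<in>UNIV. (p x * q y) *\<^sub>R (axis x 1 - axis y 1))"
    proof -
      have 1: "(\<Sum>x\<in>UNIV. \<Sum>y\<in>UNIV. (p x * q y) *\<^sub>R axis x (1::real)) = s *\<^sub>R (\<Sum>x\<in>UNIV. p x *\<^sub>R axis x 1)"
        unfolding scaleR_left.sum[symmetric] sum_distrib_left[symmetric] sq
        by (simp add: scaleR_sum_right mult.commute)
      have 2: "(\<Sum>x\<in>UNIV. \<Sum>y\<in>UNIV. (p x * q y) *\<^sub>R axis y (1::real)) = s *\<^sub>R (\<Sum>x\<in>UNIV. q x *\<^sub>R axis x 1)"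
        unfolding scaleR_scaleR[symmetric] scaleR_sum_right[symmetric] scaleR_left.sum[symmetric] s_def by simp
      show ?thesis
        unfolding scaleR_right_diff_distrib sum_subtractf 1 2 by (subst d') (simp add: scaleR_right_diff_distrib)
    qed
    then have "s *\<^sub>R run E w d = (\<Sum>x\<in>UNIV. \<Sum>y\<in>UNIV. (p x * q y) *\<^sub>R run E w (axis x 1 - axis y 1))"
      by (simp only: linear_cmul[OF linear_run, symmetric] linear_sum[OF linear_run, symmetric])
    then have "s * l1 (run E w d) = l1 (\<Sum>x\<in>UNIV. \<Sum>y\<in>UNIV. (p x * q y) *\<^sub>R run E w (axis x 1 - axis y 1))"
      using l1_scaleR[of s "run E w d"] s0 by simp
    also have "\<dots> \<le> (\<Sum>x\<in>UNIV. \<Sum>y\<in>UNIV. l1 ((p x * q y) *\<^sub>R run E w (axis x 1 - axis y 1)))"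
      by (intro order_trans[OF l1_sum] sum_mono l1_sum)
    also have "\<dots> \<le> (\<Sum>x\<in>UNIV. \<Sum>y\<in>UNIV. p x * q y * (2 * \<rho>))"
      using pq(1,2) by (intro sum_mono) (auto simp: l1_scaleR abs_mult intro!: mult_left_mono pair w)
    also have "\<dots> = s * (\<rho> * l1 d)"
      unfolding ld sum_distrib_right[symmetric] sum_distrib_left[symmetric] sq s_def[symmetric] by simp
    finally have *: "s * l1 (run E w d) \<le> s * (\<rho> * l1 d)" .
    show "l1 (run E w d) \<le> \<rho> * l1 d"
    proof (cases "s = 0")
      case True
      then show ?thesis using l1_run[of w d] ld l1_nonneg[of "run E w d"] by simp
    next
      case False
      then show ?thesis using * s0 by simp
    qed
  qed
qed

section \<open>Backward orbits\<close>

definition isolated_zero :: "'v \<Rightarrow> real ^ 'v \<Rightarrow> bool" where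
  "isolated_zero z a \<longleftrightarrow> a $ z = 0 \<and> (\<forall>x. x \<noteq> z \<longrightarrow> 0 < a $ x)"

text \<open>
  Linear independence over the integers rules out ties between masses now and, because it is
  inherited by \<open>unhit\<close> below, at all earlier times.
\<close>
definition generic :: "'v \<Rightarrow> real ^ 'v \<Rightarrow> bool" where
  "generic z a \<longleftrightarrow> isolated_zero z a \<and>
     (\<forall>q::'v \<Rightarrow> int. (\<Sum>x\<in>UNIV. of_int (q x) * a $ x) = 0 \<longrightarrow> (\<forall>x. x \<noteq> z \<longrightarrow> q x = 0))"

text \<open>
  The preimage of \<open>a\<close> under \<open>hit E z\<close> in which \<open>z\<close> is as heavy as it can be if \<open>y\<close> is the lightest neighbor
  of \<open>z\<close>: every neighbor returns the mass \<open>a $ y\<close> to \<open>z\<close>, and \<open>y\<close> becomes empty.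
\<close>
definition unhit :: "'v \<Rightarrow> 'v \<Rightarrow> real ^ 'v \<Rightarrow> real ^ 'v" where
  "unhit z y a = (\<chi> x. if x = z then deg z * a $ y
     else if (z, x) \<in> E then a $ x - a $ y else a $ x)"

lemma hit_unhit: "a $ z = 0 \<Longrightarrow> hit E z (unhit z y a) = a"
  using deg_pos[of z] loopfree[of z]
  by (auto simp: hit_def unhit_def vec_eq_iff neighbors_nonempty)

lemma unhit_eq:
  "unhit z y a $ z = deg z * a $ y"
  "(z, x) \<in> E \<Longrightarrow> unhit z y a $ x = a $ x - a $ y"
  "x \<noteq> z \<Longrightarrow> (z, x) \<notin> E \<Longrightarrow> unhit z y a $ x = a $ x"
  using loopfree[of z] by (auto simp: unhit_def)

text \<open>
  The nonzero masses of \<open>unhit z y a\<close> are obtained from those of \<open>a\<close> by an invertible rational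
  substitution, so they remain independent.  In particular no second neighbor of \<open>z\<close> becomes empty
  together with the lightest one.
\<close>
lemma generic_unhit:
  assumes "generic z a"
  shows "\<exists>y. (z, y) \<in> E \<and> generic y (unhit z y a)"
proof -
  have az: "a $ z = 0" and pos: "\<And>x. x \<noteq> z \<Longrightarrow> 0 < a $ x"
    and ind: "\<And>q x. (\<Sum>x\<in>UNIV. of_int (q x) * a $ x) = 0 \<Longrightarrow> x \<noteq> z \<Longrightarrow> q x = (0::int)"
    using assms unfolding generic_def isolated_zero_def by blast+
  obtain y where y: "(z, y) \<in> E" and y_min: "\<And>x. (z, x) \<in> E \<Longrightarrow> a $ y \<le> a $ x"
    using ex_is_arg_min_if_finite[of "E `` {z}" "\<lambda>x. a $ x"] neighbors_nonempty[of z]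
    by (auto simp: is_arg_min_linorder)
  have yz: "y \<noteq> z" using y loopfree by auto
  define b where "b = unhit z y a"
  have distinct: "a $ x \<noteq> a $ y" if "x \<noteq> z" "x \<noteq> y" for x
  proof
    assume "a $ x = a $ y"
    moreover have "(\<Sum>u\<in>UNIV. of_int ((if u = x then 1 else 0) - (if u = y then 1 else 0)) * a $ u) =
        (\<Sum>u\<in>UNIV. (if u = x then a $ x else 0) - (if u = y then a $ y else 0))"
      using that by (intro sum.cong) auto
    ultimately have "(\<Sum>u\<in>UNIV. of_int ((if u = x then 1 else 0) - (if u = y then 1 else 0)) * a $ u) = 0"
      by (simp add: sum_subtractf)
    from ind[OF this, of x] that show False by simp
  qed
  have "isolated_zero y b"
    unfolding isolated_zero_def
  proof (intro conjI allI impI)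
    show "b $ y = 0" using y by (simp add: b_def unhit_eq)
    fix x assume x: "x \<noteq> y"
    consider "x = z" | "(z, x) \<in> E" | "x \<noteq> z" "(z, x) \<notin> E" by blast
    then show "0 < b $ x"
    proof cases
      case 1
      then show ?thesis using deg_pos[of z] pos[OF yz] by (simp add: b_def unhit_eq)
    next
      case 2
      then have "x \<noteq> z" using loopfree by auto
      then show ?thesis using 2 y_min[OF 2] distinct[OF _ x] by (simp add: b_def unhit_eq)
    next
      case 3
      then show ?thesis using pos by (simp add: b_def unhit_eq)
    qed
  qed
  moreover have "q x = 0" if q: "(\<Sum>x\<in>UNIV. of_int (q x) * b $ x) = 0" and x: "x \<noteq> y"
    for q :: "'v \<Rightarrow> int" and x
  proof -
    \<comment> \<open>Substituting \<open>b = unhit z y a\<close> turns the relation \<open>q\<close> between the masses of \<open>b\<close> into a relation \<open>p\<close>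
      between those of \<open>a\<close>; \<open>c\<close> collects the occurrences of \<open>a $ y\<close> that come from \<open>z\<close> and its neighbors.\<close>
    define c where "c = q z * int (card (E `` {z})) - (\<Sum>x\<in>E `` {z}. q x)"
    define p where "p x = (if x = z then 0 else q x) + (if x = y then c else 0)" for x
    have "of_int (q u) * b $ u = of_int (q u) * a $ u - (if u = z then of_int (q z) * a $ z else 0)
        + (if u = z then of_int (q z) * deg z * a $ y else 0) - (if (z, u) \<in> E then of_int (q u) * a $ y else 0)" for u
      using loopfree by (auto simp: b_def unhit_def algebra_simps)
    then have "(\<Sum>u\<in>UNIV. of_int (q u) * b $ u) =
        (\<Sum>u\<in>UNIV. of_int (q u) * a $ u) - of_int (q z) * a $ z + of_int (q z) * deg z * a $ y
        - (\<Sum>u\<in>UNIV. if (z, u) \<in> E then of_int (q u) * a $ y else 0)"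
      by (simp add: sum.distrib sum_subtractf)
    also have "(\<Sum>u\<in>UNIV. if (z, u) \<in> E then of_int (q u) * a $ y else 0) = (\<Sum>u\<in>E `` {z}. of_int (q u) * a $ y)"
      by (rule sum.mono_neutral_cong_right) auto
    also have "(\<Sum>u\<in>UNIV. of_int (q u) * a $ u) - of_int (q z) * a $ z + of_int (q z) * deg z * a $ y
        - (\<Sum>u\<in>E `` {z}. of_int (q u) * a $ y) =
        (\<Sum>u\<in>UNIV. of_int (q u) * a $ u) - of_int (q z) * a $ z + of_int c * a $ y"
      by (simp add: c_def left_diff_distrib sum_distrib_right)
    also have "\<dots> = (\<Sum>u\<in>UNIV. of_int (q u) * a $ u - (if u = z then of_int (q z) * a $ z else 0)
        + (if u = y then of_int c * a $ y else 0))"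
      by (simp add: sum.distrib sum_subtractf)
    also have "\<dots> = (\<Sum>u\<in>UNIV. of_int (p u) * a $ u)"
      by (rule sum.cong) (auto simp: p_def algebra_simps)
    finally have p0: "p u = 0" if "u \<noteq> z" for u using ind[of p u] q that by simp
    have q0: "q u = 0" if "u \<noteq> z" "u \<noteq> y" for u using p0[of u] that by (simp add: p_def)
    have "(\<Sum>u\<in>E `` {z}. q u) = (\<Sum>u\<in>E `` {z}. if u = y then q y else 0)"
    proof (intro sum.cong refl)
      fix u assume "u \<in> E `` {z}"
      then have "u \<noteq> z" using loopfree by auto
      then show "q u = (if u = y then q y else 0)" using q0 by simp
    qed
    then have "q y + c = q z * int (card (E `` {z}))" using y by (simp add: c_def)
    moreover have "q y + c = 0" using p0[OF yz] yz by (simp add: p_def)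
    ultimately have "q z = 0" using neighbors_nonempty[of z] by simp
    then show "q x = 0" using q0 x by (cases "x = z") auto
  qed
  ultimately have "generic y b" unfolding generic_def by blast
  then show ?thesis using y b_def by blast
qed

text \<open>Increasing \<open>n\<close> goes back in time: \<open>a n\<close> arises from \<open>a (Suc n)\<close> by a hit at \<open>z n\<close>.\<close>
definition backward_orbit :: "(nat \<Rightarrow> 'v) \<Rightarrow> (nat \<Rightarrow> real ^ 'v) \<Rightarrow> bool" where
  "backward_orbit z a \<longleftrightarrow> (\<forall>n. isolated_zero (z n) (a n) \<and> (z n, z (Suc n)) \<in> E \<and>
     a (Suc n) = unhit (z n) (z (Suc n)) (a n))"

lemma backward_orbit_exists:
  assumes "generic z0 a0"
  obtains z a where "backward_orbit z a" "z 0 = z0" "a 0 = a0"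
proof -
  have "\<exists>f. \<forall>n. (generic (fst (f n)) (snd (f n)) \<and> (n = 0 \<longrightarrow> f n = (z0, a0))) \<and>
      ((fst (f n), fst (f (Suc n))) \<in> E \<and>
       snd (f (Suc n)) = unhit (fst (f n)) (fst (f (Suc n))) (snd (f n)))"
  proof (rule dependent_nat_choice)
    show "\<exists>x. generic (fst x) (snd x) \<and> (0 = 0 \<longrightarrow> x = (z0, a0))"
      using assms by (intro exI[of _ "(z0, a0)"]) simp
    fix x :: "'v \<times> (real ^ 'v)" and n :: nat
    assume "generic (fst x) (snd x) \<and> (n = 0 \<longrightarrow> x = (z0, a0))"
    then obtain y where "(fst x, y) \<in> E" "generic y (unhit (fst x) y (snd x))"
      using generic_unhit by blast
    then show "\<exists>x'. (generic (fst x') (snd x') \<and> (Suc n = 0 \<longrightarrow> x' = (z0, a0))) \<and>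
       (fst x, fst x') \<in> E \<and> snd x' = unhit (fst x) (fst x') (snd x)"
      by (intro exI[of _ "(y, unhit (fst x) y (snd x))"]) simp
  qed
  then obtain f where f: "\<And>n. generic (fst (f n)) (snd (f n))" "f 0 = (z0, a0)"
      "\<And>n. (fst (f n), fst (f (Suc n))) \<in> E"
      "\<And>n. snd (f (Suc n)) = unhit (fst (f n)) (fst (f (Suc n))) (snd (f n))"
    by metis
  show ?thesis
    using f by (intro that[of "\<lambda>n. fst (f n)" "\<lambda>n. snd (f n)"]) (auto simp: backward_orbit_def generic_def)
qed

context
  fixes z a assumes orbit: "backward_orbit z a"
begin

lemma orbit_zero: "a n $ z n = 0"
  and orbit_pos: "x \<noteq> z n \<Longrightarrow> 0 < a n $ x"
  and orbit_edge: "(z n, z (Suc n)) \<in> E"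
  and orbit_step: "a (Suc n) = unhit (z n) (z (Suc n)) (a n)"
  using orbit unfolding backward_orbit_def isolated_zero_def by blast+

lemma orbit_nonneg: "0 \<le> a n $ x"
  using orbit_zero[of n] orbit_pos[of x n] by (cases "x = z n") auto

lemma orbit_hit: "hit E (z n) (a (Suc n)) = a n"
  by (simp add: orbit_step hit_unhit orbit_zero)

lemma orbit_run: "run E (map z [0..<n]) (a n) = a 0"
  by (induction n) (simp_all add: orbit_hit)

lemma orbit_mass: "mass (a n) = mass (a 0)"
  using mass_run[of "map z [0..<n]" "a n"] by (simp add: orbit_run)

lemma orbit_decreasing: "z n \<noteq> x \<Longrightarrow> a (Suc n) $ x \<le> a n $ x"
  using orbit_nonneg[of n "z (Suc n)"]
  by (cases "(z n, x) \<in> E") (auto simp: orbit_step unhit_eq)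

text \<open>
  A vertex gains mass only when it is the empty one, and then its gain is tied to the loss of any
  of its neighbors.  Therefore convergence spreads along edges.
\<close>
lemma orbit_refill:
  assumes "(x, y) \<in> E" "z n = x"
  shows "a (Suc n) $ x = deg x * (a n $ y - a (Suc n) $ y)"
  using assms by (simp add: orbit_step unhit_eq)

text \<open>
  Each visit empties \<open>x\<close> and refills it with an amount proportional to the simultaneous loss at \<open>y\<close>.  These
  losses tend to \<open>0\<close>, and between visits the mass at \<open>x\<close> does not grow.
\<close>
lemma orbit_vanishes:
  assumes y: "convergent (\<lambda>n. a n $ y)" and xy: "(x, y) \<in> E" and inf: "infinite {n. z n = x}"
  shows "(\<lambda>n. a n $ x) \<longlonglongrightarrow> 0"
proof (rule LIMSEQ_I)
  fix e :: real assume e: "0 < e"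
  obtain L where L: "(\<lambda>n. a n $ y) \<longlonglongrightarrow> L" using y by (auto simp: convergent_def)
  have "(\<lambda>n. deg x * (a n $ y - a (Suc n) $ y)) \<longlonglongrightarrow> deg x * (L - L)"
    by (intro tendsto_intros L LIMSEQ_Suc[OF L])
  then have "\<forall>\<^sub>F n in sequentially. deg x * (a n $ y - a (Suc n) $ y) < e"
    using e by (intro order_tendstoD) auto
  then obtain N where N: "\<And>n. N \<le> n \<Longrightarrow> deg x * (a n $ y - a (Suc n) $ y) < e"
    by (auto simp: eventually_sequentially)
  obtain N' where N': "N \<le> N'" "z N' = x"
    using inf unfolding infinite_nat_iff_unbounded_le by auto
  have "a n $ x < e" if "N' \<le> n" for n
    using that
  proof (induction n rule: dec_induct)
    case base
    then show ?case using N'(2) orbit_zero[of N'] e by simp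
  next
    case (step n)
    then show ?case
      using N[of n] N'(1) orbit_refill[OF xy, of n] orbit_decreasing[of n x]
      by (cases "z n = x") auto
  qed
  then show "\<exists>no. \<forall>n\<ge>no. norm (a n $ x - 0) < e"
    using orbit_nonneg by (intro exI[of _ N']) auto
qed

lemma orbit_convergent_if_rare:
  assumes "finite {n. z n = x}"
  shows "convergent (\<lambda>n. a n $ x)"
proof -
  obtain N' where N': "\<And>n. z n = x \<Longrightarrow> n \<le> N'"
    using assms unfolding finite_nat_set_iff_bounded_le by auto
  define N where "N = Suc N'"
  have N: "z n \<noteq> x" if "N \<le> n" for n
    using N'[of n] that by (auto simp: N_def)
  have "decseq (\<lambda>n. a (n + N) $ x)"
    by (rule decseq_SucI) (use N orbit_decreasing in auto)
  then have "convergent (\<lambda>n. a (n + N) $ x)"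
    by (intro Bseq_monoseq_convergent decseq_imp_monoseq decseq_bounded[where B = 0]) (auto simp: orbit_nonneg)
  then show ?thesis by (rule iffD1[OF convergent_ignore_initial_segment[of "\<lambda>n. a n $ x" N]])
qed

text \<open>
  If \<open>x\<close> is visited finitely often, convergence starts at \<open>x\<close> and spreads over the whole graph.  All
  mass then accumulates on the set \<open>B\<close> of vertices with finitely many visits.  But from some time \<open>N\<close> on
  the mass on \<open>B\<close> is nonincreasing, so \<open>B\<close> carries all mass already at time \<open>N\<close>, although the next
  vertex to be visited lies outside \<open>B\<close> and is not empty.
\<close>
lemma orbit_recurrent: "infinite {n. z n = x}"
proof
  assume fin: "finite {n. z n = x}"
  have conv: "convergent (\<lambda>n. a n $ y)" for y
    using connected[of x y]
  proof (induction rule: rtrancl_induct)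
    case base
    show ?case by (rule orbit_convergent_if_rare[OF fin])
  next
    case (step u v)
    show ?case
    proof (cases "finite {n. z n = v}")
      case True
      then show ?thesis by (rule orbit_convergent_if_rare)
    next
      case False
      then show ?thesis
        using orbit_vanishes[OF step.IH symmetric[OF step.hyps(2)]] by (auto simp: convergent_def)
    qed
  qed
  define B where "B = {y. finite {n. z n = y}}"
  have lim: "(\<lambda>n. a n $ y) \<longlonglongrightarrow> 0" if "y \<notin> B" for y
    using that has_neighbor[of y] orbit_vanishes[OF conv] by (auto simp: B_def)
  have "finite (\<Union>y\<in>B. {n. z n = y})" by (auto simp: B_def)
  then obtain N' where N': "\<And>n. z n \<in> B \<Longrightarrow> n \<le> N'"
    unfolding finite_nat_set_iff_bounded_le by auto
  define N where "N = Suc N'"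
  have N: "z n \<notin> B" if "N \<le> n" for n
    using N'[of n] that by (auto simp: N_def)
  define f where "f n = (\<Sum>y\<in>B. a (n + N) $ y)" for n
  define k where "k = mass (a 0)"
  have split: "k = (\<Sum>y\<in>B. a n $ y) + (\<Sum>y\<in>-B. a n $ y)" for n
    using orbit_mass[of n] sum.subset_diff[of B UNIV "\<lambda>y. a n $ y"]
    unfolding k_def mass_def Compl_eq_Diff_UNIV by simp
  have "(\<lambda>n. \<Sum>y\<in>-B. a n $ y) \<longlonglongrightarrow> (\<Sum>y\<in>-B. 0)"
    using lim by (intro tendsto_sum) auto
  then have "(\<lambda>n. k - (\<Sum>y\<in>-B. a n $ y)) \<longlonglongrightarrow> k - 0"
    by (intro tendsto_intros) simp
  moreover have "k - (\<Sum>y\<in>-B. a n $ y) = (\<Sum>y\<in>B. a n $ y)" for n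
    using split[of n] by linarith
  ultimately have "(\<lambda>n. \<Sum>y\<in>B. a n $ y) \<longlonglongrightarrow> k" by simp
  then have "f \<longlonglongrightarrow> k" unfolding f_def by (rule LIMSEQ_ignore_initial_segment)
  moreover have "decseq f"
    unfolding f_def by (rule decseq_SucI) (use N in \<open>auto intro!: sum_mono orbit_decreasing\<close>)
  ultimately have "k \<le> f 0" by (rule decseq_ge[rotated])
  then have "(\<Sum>y\<in>-B. a N $ y) \<le> 0" using split[of N] by (simp add: f_def)
  moreover have "0 < a N $ z (Suc N)"
    using orbit_pos[of "z (Suc N)" N] orbit_edge[of N] loopfree by metis
  then have "0 < (\<Sum>y\<in>-B. a N $ y)"
    using N[of "Suc N"] by (intro sum_pos2[of _ "z (Suc N)"]) (auto simp: orbit_nonneg)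
  ultimately show False by simp
qed

lemma orbit_sweeps: "\<exists>m\<ge>N. sweeps r (map z [N..<m])"
proof (induction r)
  case 0
  show ?case by (rule exI[of _ N]) (unfold sweeps.simps, blast)
next
  case (Suc r)
  then obtain m where m: "N \<le> m" "sweeps r (map z [N..<m])" by blast
  have "\<forall>x. \<exists>n\<ge>m. z n = x"
  proof
    fix x
    show "\<exists>n\<ge>m. z n = x"
      using iffD1[OF infinite_nat_iff_unbounded_le orbit_recurrent[of x]] by simp
  qed
  then obtain t where t: "\<And>x. m \<le> t x" "\<And>x. z (t x) = x" by metis
  define l where "l = Suc (Max (range t))"
  have tl: "t x < l" for x unfolding l_def by (simp add: less_Suc_eq_le)
  have ml: "m \<le> l" using t(1)[of undefined] tl[of undefined] by linarith
  have "x \<in> set (map z [m..<l])" for x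
    unfolding set_map by (rule image_eqI[of _ _ "t x"]) (use t tl in auto)
  then have "set (map z [m..<l]) = UNIV" by blast
  moreover have "map z [N..<l] = map z [N..<m] @ map z [m..<l]"
    using upt_add_eq_append[of N m "l - m"] m(1) ml by simp
  ultimately have "sweeps (Suc r) (map z [N..<l])" unfolding sweeps.simps using m(2) by blast
  then show ?case using m(1) ml by (intro exI[of _ l]) simp
qed

end

text \<open>
  The hits of a long piece of the orbit map \<open>a n\<close> to \<open>a 0\<close> exactly, and \<open>b\<close> to nearly the same state,
  because the piece contains many sweeps and \<open>b - a n\<close> has mass zero and bounded norm.
\<close>
lemma orbit_attracts:
  assumes orbit: "backward_orbit z a" and "mass b = mass (a 0)" "\<And>x. 0 \<le> b $ x" "0 < e"
  shows "\<exists>w. l1 (run E w b - a 0) < e"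
proof -
  note orbit_run = orbit_run[OF orbit] and orbit_mass = orbit_mass[OF orbit] and orbit_nonneg = orbit_nonneg[OF orbit]
    and orbit_sweeps = orbit_sweeps[OF orbit]
  obtain \<rho> :: real and R where \<rho>: "0 \<le> \<rho>" "\<rho> < 1"
    and contr: "\<And>w d. sweeps R w \<Longrightarrow> mass d = 0 \<Longrightarrow> l1 (run E w d) \<le> \<rho> * l1 d"
    by (rule uniform_contraction) (rule that)
  have "\<exists>m. \<forall>d. mass d = 0 \<longrightarrow> l1 (run E (map z [0..<m]) d) \<le> \<rho> ^ j * l1 d" for j
  proof (induction j)
    case 0
    show ?case by (intro exI[of _ 0]) simp
  next
    case (Suc j)
    then obtain m where m: "\<And>d. mass d = 0 \<Longrightarrow> l1 (run E (map z [0..<m]) d) \<le> \<rho> ^ j * l1 d" by blast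
    obtain l where l: "m \<le> l" "sweeps R (map z [m..<l])" using orbit_sweeps[of m R] by blast
    have "[0..<l] = [0..<m] @ [m..<l]"
      using upt_add_eq_append[of 0 m "l - m"] l(1) by simp
    then have eq: "run E (map z [0..<l]) d = run E (map z [0..<m]) (run E (map z [m..<l]) d)" for d
      by simp
    have "l1 (run E (map z [0..<l]) d) \<le> \<rho> ^ Suc j * l1 d" if "mass d = 0" for d
    proof -
      have "l1 (run E (map z [0..<l]) d) \<le> \<rho> ^ j * l1 (run E (map z [m..<l]) d)"
        unfolding eq using that by (intro m) (simp add: mass_run)
      also have "\<dots> \<le> \<rho> ^ j * (\<rho> * l1 d)"
        using \<rho>(1) by (intro mult_left_mono contr l(2) that) simp
      finally show ?thesis by (simp add: mult.assoc mult.left_commute)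
    qed
    then show ?case by blast
  qed
  then have "\<exists>m. \<forall>j d. mass d = 0 \<longrightarrow> l1 (run E (map z [0..<m j]) d) \<le> \<rho> ^ j * l1 d"
    by (rule choice[OF allI])
  then obtain m where m: "\<And>j d. mass d = 0 \<Longrightarrow> l1 (run E (map z [0..<m j]) d) \<le> \<rho> ^ j * l1 d" by blast
  define k where "k = mass (a 0)"
  have ak: "mass (a n) = k" for n unfolding k_def by (rule orbit_mass)
  have bk: "mass b = k" using assms(2) by (simp add: k_def)
  have bound: "l1 (run E (map z [0..<m j]) b - a 0) \<le> \<rho> ^ j * (2 * k)" for j
  proof -
    have "run E (map z [0..<m j]) b - a 0 = run E (map z [0..<m j]) (b - a (m j))"
      using linear_diff[OF linear_run, of E "map z [0..<m j]" b "a (m j)"] by (simp only: orbit_run)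
    also have "l1 \<dots> \<le> \<rho> ^ j * l1 (b - a (m j))"
      by (rule m) (simp add: mass_diff ak bk)
    also have "\<dots> \<le> \<rho> ^ j * (2 * k)"
    proof (rule mult_left_mono)
      show "l1 (b - a (m j)) \<le> 2 * k"
        using l1_diff[of b "a (m j)"] l1_eq_mass[OF assms(3)] l1_eq_mass[OF orbit_nonneg, of "m j"]
        by (simp add: ak bk)
    qed (use \<rho>(1) in simp)
    finally show ?thesis .
  qed
  have "(\<lambda>j. \<rho> ^ j * (2 * k)) \<longlonglongrightarrow> 0 * (2 * k)"
    using \<rho> by (intro tendsto_intros LIMSEQ_power_zero) simp
  then have "\<forall>\<^sub>F j in sequentially. \<rho> ^ j * (2 * k) < e"
    using assms(4) by (intro order_tendstoD) auto
  then obtain j where "\<rho> ^ j * (2 * k) < e"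
    using eventually_happens'[OF sequentially_bot] by blast
  with bound[of j] have "l1 (run E (map z [0..<m j]) b - a 0) < e" by (rule le_less_trans)
  then show ?thesis by blast
qed

section \<open>Approximation of states with an empty vertex\<close>

text \<open>
  Choose the coordinates one after the other: the rational linear combinations of those already
  chosen form a countable set, so every interval contains a value outside of it.
\<close>
lemma generic_coordinates:
  fixes a :: "'v \<Rightarrow> real"
  assumes "finite F" "0 < e" "\<And>x. 0 \<le> a x"
  shows "\<exists>c::'v \<Rightarrow> real. (\<forall>x\<in>F. 0 < c x \<and> \<bar>c x - a x\<bar> < e) \<and>
    (\<forall>q::'v \<Rightarrow> int. (\<Sum>x\<in>F. of_int (q x) * c x) = 0 \<longrightarrow> (\<forall>x\<in>F. q x = 0))"
  using assms(1)
proof (induction F)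
  case empty
  show ?case by (rule exI[of _ "\<lambda>_. 1"]) auto
next
  case (insert y F)
  obtain c where c: "\<forall>x\<in>F. 0 < c x \<and> \<bar>c x - a x\<bar> < e"
    and ind: "\<forall>q::'v \<Rightarrow> int. (\<Sum>x\<in>F. of_int (q x) * c x) = 0 \<longrightarrow> (\<forall>x\<in>F. q x = 0)"
    using insert.IH by (elim exE conjE) (rule that)
  define S where "S = range (\<lambda>(q::'v \<Rightarrow> int, p::int). - (\<Sum>x\<in>F. of_int (q x) * c x) / of_int p)"
  have "countable S" unfolding S_def by simp
  moreover have "uncountable {a y <..< a y + e}" using assms(2) by (simp add: uncountable_open_interval)
  ultimately have "\<not> {a y <..< a y + e} \<subseteq> S" by (auto dest: countable_subset)
  then obtain s where s: "s \<in> {a y <..< a y + e}" "s \<notin> S" by blast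
  define c' where "c' = c(y := s)"
  have F: "x \<noteq> y" if "x \<in> F" for x using that insert.hyps by auto
  have gen: "q x = 0" if q: "(\<Sum>x\<in>insert y F. of_int (q x) * c' x) = 0" and x: "x \<in> insert y F"
    for q :: "'v \<Rightarrow> int" and x
  proof -
    have *: "of_int (q y) * s + (\<Sum>x\<in>F. of_int (q x) * c x) = 0"
    proof -
      have "(\<Sum>x\<in>F. of_int (q x) * c' x) = (\<Sum>x\<in>F. of_int (q x) * c x)"
        by (rule sum.cong) (simp_all add: c'_def F)
      then show ?thesis using q insert.hyps by (simp add: c'_def)
    qed
    have "q y = 0"
    proof (rule ccontr)
      assume "q y \<noteq> 0"
      then have "s = - (\<Sum>x\<in>F. of_int (q x) * c x) / of_int (q y)"
        using * by (simp add: field_simps)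
      then have "s \<in> S" unfolding S_def by (intro range_eqI[of _ _ "(q, q y)"]) simp
      then show False using s(2) by contradiction
    qed
    moreover have "q x = 0" if "x \<in> F" for x using ind * \<open>q y = 0\<close> that by simp
    ultimately show ?thesis using x by auto
  qed
  have close: "0 < c' x \<and> \<bar>c' x - a x\<bar> < e" if "x \<in> insert y F" for x
    using that c s(1) assms(3)[of y] F by (auto simp: c'_def)
  show ?case
  proof (rule exI[of _ c'], rule conjI)
    show "\<forall>x\<in>insert y F. 0 < c' x \<and> \<bar>c' x - a x\<bar> < e" by (rule ballI) (rule close)
    show "\<forall>q::'v \<Rightarrow> int. (\<Sum>x\<in>insert y F. of_int (q x) * c' x) = 0 \<longrightarrow> (\<forall>x\<in>insert y F. q x = 0)"
      by (intro allI impI ballI) (rule gen)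
  qed
qed

lemma generic_scaleR:
  assumes "generic z a" "0 < s"
  shows "generic z (s *\<^sub>R a)"
proof -
  have "(\<Sum>x\<in>UNIV. of_int (q x) * a $ x) = 0" if "(\<Sum>x\<in>UNIV. of_int (q x) * (s *\<^sub>R a) $ x) = 0"
    for q :: "'v \<Rightarrow> int"
  proof -
    have "s * (\<Sum>x\<in>UNIV. of_int (q x) * a $ x) = 0"
      using that by (simp add: sum_distrib_left mult.left_commute)
    then show ?thesis using assms(2) by simp
  qed
  then show ?thesis using assms unfolding generic_def isolated_zero_def by auto
qed

text \<open>
  Perturb the coordinates other than \<open>z\<close> first and restore the mass by scaling afterwards, which
  preserves independence and costs no more than the perturbation.
\<close>
lemma generic_dense:
  assumes "\<And>x. 0 \<le> a $ x" "a $ z = 0" "0 < mass a" "0 < e"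
  shows "\<exists>b. generic z b \<and> mass b = mass a \<and> l1 (b - a) < e"
proof -
  define \<eta> where "\<eta> = e / (2 * real CARD('v))"
  have \<eta>: "0 < \<eta>" using assms(4) by (simp add: \<eta>_def)
  have "\<exists>c. (\<forall>x\<in>-{z}. 0 < c x \<and> \<bar>c x - a $ x\<bar> < \<eta>) \<and>
      (\<forall>q::'v \<Rightarrow> int. (\<Sum>x\<in>-{z}. of_int (q x) * c x) = 0 \<longrightarrow> (\<forall>x\<in>-{z}. q x = 0))"
    by (rule generic_coordinates) (use \<eta> assms(1) in auto)
  then obtain c where c: "\<forall>x\<in>-{z}. 0 < c x \<and> \<bar>c x - a $ x\<bar> < \<eta>"
    and ind: "\<forall>q::'v \<Rightarrow> int. (\<Sum>x\<in>-{z}. of_int (q x) * c x) = 0 \<longrightarrow> (\<forall>x\<in>-{z}. q x = 0)"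
    by (elim exE conjE) (rule that)
  define b where "b = (\<chi> x. if x = z then 0 else c x)"
  have cpos: "0 < c x" if "x \<noteq> z" for x using c that by auto
  have bz: "b $ z = 0" and bx: "x \<noteq> z \<Longrightarrow> b $ x = c x" for x by (auto simp: b_def)
  have sum_b: "(\<Sum>x\<in>UNIV. of_int (q x) * b $ x) = (\<Sum>x\<in>-{z}. of_int (q x) * c x)" for q :: "'v \<Rightarrow> int"
    by (rule sum.mono_neutral_cong_right) (auto simp: b_def)
  have gen: "generic z b"
    unfolding generic_def isolated_zero_def sum_b
    using ind by (intro conjI allI impI) (simp_all add: bz bx cpos)
  have bnn: "0 \<le> b $ x" for x using cpos[of x] by (auto simp: b_def)
  have "l1 (b - a) < (\<Sum>x\<in>(UNIV::'v set). \<eta>)"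
    unfolding l1_def
  proof (rule sum_strict_mono)
    show "\<bar>(b - a) $ x\<bar> < \<eta>" for x
      using c assms(2) \<eta> by (cases "x = z") (simp_all add: bz bx)
  qed simp_all
  then have close: "2 * l1 (b - a) < e" by (simp add: \<eta>_def field_simps)
  obtain y where y: "(z, y) \<in> E" using has_neighbor by blast
  then have "y \<noteq> z" using loopfree by auto
  then have mb: "0 < mass b"
    unfolding mass_def using cpos[of y] bx[of y] by (intro sum_pos2[of _ y]) (simp_all add: bnn)
  define s where "s = mass a / mass b"
  have "l1 (s *\<^sub>R b - a) \<le> l1 ((s - 1) *\<^sub>R b) + l1 (b - a)"
    using l1_add[of "(s - 1) *\<^sub>R b" "b - a"] by (simp add: scaleR_left_diff_distrib)
  also have "l1 ((s - 1) *\<^sub>R b) = \<bar>(s - 1) * mass b\<bar>"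
    using mb by (simp add: l1_scaleR l1_eq_mass[OF bnn] abs_mult)
  also have "(s - 1) * mass b = mass (a - b)"
    using mb by (simp add: s_def mass_diff field_simps)
  also have "\<bar>mass (a - b)\<bar> \<le> l1 (b - a)"
    using abs_mass_le_l1[of "b - a"] by (simp add: mass_diff)
  finally have "l1 (s *\<^sub>R b - a) < e" using close by simp
  moreover have "generic z (s *\<^sub>R b)"
    using generic_scaleR[OF gen] assms(3) mb by (simp add: s_def)
  moreover have "mass (s *\<^sub>R b) = mass a" using mb by (simp add: mass_scaleR s_def)
  ultimately show ?thesis by blast
qed

theorem meteor_approximation:
  assumes "\<And>x. 0 \<le> b $ x" "mass b = mass a" "\<And>x. 0 \<le> a $ x" "a $ z = 0" "0 < mass a" "0 < e"
  shows "\<exists>w. norm (run E w b - a) < e"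
proof -
  have "\<exists>a'. generic z a' \<and> mass a' = mass a \<and> l1 (a' - a) < e / 2"
    by (rule generic_dense) (use assms in auto)
  then obtain a' where a': "generic z a'" "mass a' = mass a" "l1 (a' - a) < e / 2" by blast
  obtain \<zeta> \<alpha> where orbit: "backward_orbit \<zeta> \<alpha>" and a0: "\<alpha> 0 = a'"
    using backward_orbit_exists[OF a'(1)] by blast
  have "\<exists>w. l1 (run E w b - \<alpha> 0) < e / 2"
    by (rule orbit_attracts[OF orbit]) (use a0 a'(2) assms in auto)
  then obtain w where "l1 (run E w b - a') < e / 2" unfolding a0 by blast
  then have "l1 (run E w b - a) < e"
    using a'(3) l1_add[of "run E w b - a'" "a' - a"] by simp
  then have "norm (run E w b - a) < e" by (rule le_less_trans[OF norm_le_l1])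
  then show ?thesis by blast
qed

end

section \<open>Paths of the meteor process\<close>

definition counting_path :: "(real \<Rightarrow> nat) \<Rightarrow> bool" where
  "counting_path n \<longleftrightarrow> n 0 = 0 \<and> mono_on {0..} n \<and> (\<forall>t\<ge>0. continuous (at_right t) n)"

lemma left_limit_eqI:
  assumes "a < t" "\<And>s. a < s \<Longrightarrow> s < t \<Longrightarrow> f s = c"
  shows "left_limit f t = c"
proof -
  have "\<forall>\<^sub>F s in at_left t. f s = c"
    unfolding eventually_at_left_field using assms by blast
  then have "(f \<longlongrightarrow> c) (at_left t)" by (rule tendsto_eventually)
  then show ?thesis unfolding left_limit_def by (intro tendsto_Lim) simp_all
qed

lemma counting_path_mono: "counting_path n \<Longrightarrow> 0 \<le> s \<Longrightarrow> s \<le> t \<Longrightarrow> n s \<le> n t"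
  unfolding counting_path_def by (auto elim: mono_onD)

lemma no_jump_if_constant:
  assumes n: "counting_path n" and "0 \<le> s" "n s = n t" and u: "u \<in> {s<..t}"
  shows "\<not> jump_time n u"
proof -
  have eq: "n r = n t" if "s \<le> r" "r \<le> t" for r
    using counting_path_mono[OF n, of s r] counting_path_mono[OF n, of r t] assms that by simp
  have "left_limit n u = n t" using u by (intro left_limit_eqI[of s]) (auto intro: eq)
  then show ?thesis using u eq[of u] by (simp add: jump_time_def)
qed

text \<open>
  The last jump in an interval is the first time at which the final value is attained; right
  continuity makes this a minimum.
\<close>
lemma last_jump:
  assumes n: "counting_path n" and i: "0 \<le> i" "i \<le> j" "n i < n j"
  obtains \<tau> where "\<tau> \<in> {i<..j}" "jump_time n \<tau>" "\<And>s. s \<in> {i..<\<tau>} \<Longrightarrow> n s < n j"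
    "\<And>s. s \<in> {\<tau>..j} \<Longrightarrow> n s = n j"
proof -
  define S where "S = {s \<in> {i..j}. n s = n j}"
  define \<tau> where "\<tau> = Inf S"
  have jS: "j \<in> S" using i by (simp add: S_def)
  have lb: "bdd_below S" by (rule bdd_belowI[of _ i]) (simp add: S_def)
  have i\<tau>: "i \<le> \<tau>" unfolding \<tau>_def using jS by (intro cInf_greatest) (auto simp: S_def)
  have \<tau>j: "\<tau> \<le> j" unfolding \<tau>_def by (rule cInf_lower[OF jS lb])
  have above: "n s = n j" if "\<tau> < s" "s \<le> j" for s
  proof -
    obtain r where r: "r \<in> S" "r < s"
      using cInf_less_iff[of S s] jS lb \<open>\<tau> < s\<close> unfolding \<tau>_def by blast
    then show ?thesis
      using counting_path_mono[OF n, of r s] counting_path_mono[OF n, of s j] i that by (auto simp: S_def)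
  qed
  have at\<tau>: "n \<tau> = n j"
  proof (cases "\<tau> = j")
    case False
    then have "\<forall>\<^sub>F s in at_right \<tau>. n s = n j"
      unfolding eventually_at_right_field
    proof (intro exI[of _ j] conjI allI impI)
      show "\<tau> < j" using False \<tau>j by simp
    qed (rule above, simp_all)
    then have "(n \<longlongrightarrow> n j) (at_right \<tau>)" by (rule tendsto_eventually)
    moreover have "(n \<longlongrightarrow> n \<tau>) (at_right \<tau>)"
      using n i i\<tau> unfolding counting_path_def by (simp add: continuous_within)
    ultimately show ?thesis using tendsto_unique[of "at_right \<tau>"] by fastforce
  qed simp
  have \<tau>i: "i < \<tau>" using i\<tau> at\<tau> i(3) by (cases "i = \<tau>") auto
  have below: "n s < n j" if "s \<in> {i..<\<tau>}" for s
  proof -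
    have "s \<notin> S" using that cInf_lower[OF _ lb, of s] unfolding \<tau>_def by auto
    then have "n s \<noteq> n j" using that \<tau>j by (simp add: S_def)
    then show ?thesis using counting_path_mono[OF n, of s j] that i \<tau>j by simp
  qed
  \<comment> \<open>A nondecreasing integer path is constant to the left of \<open>\<tau>\<close>, hence has a left limit there.\<close>
  have "finite (n ` {i..<\<tau>})"
    by (rule finite_subset[of _ "{..n j}"]) (use below in \<open>auto intro: less_imp_le\<close>)
  moreover have "n ` {i..<\<tau>} \<noteq> {}" using \<tau>i by simp
  ultimately have "Max (n ` {i..<\<tau>}) \<in> n ` {i..<\<tau>}" by (rule Max_in)
  then obtain s0 where s0: "s0 \<in> {i..<\<tau>}" "n s0 = Max (n ` {i..<\<tau>})" by (metis imageE)
  have "left_limit n \<tau> = n s0"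
  proof (rule left_limit_eqI[of s0])
    show "s0 < \<tau>" using s0 by simp
    fix s assume s: "s0 < s" "s < \<tau>"
    have "n s \<le> n s0"
      unfolding s0(2) using s s0(1) \<open>finite (n ` {i..<\<tau>})\<close> by (intro Max_ge) auto
    then show "n s = n s0"
      using counting_path_mono[OF n, of s0 s] s s0(1) i by simp
  qed
  then have "jump_time n \<tau>"
    using below[OF s0(1)] at\<tau> \<tau>i i by (simp add: jump_time_def)
  have "\<tau> \<in> {i<..j}" using \<tau>i \<tau>j by simp
  then show ?thesis
  proof (rule that[OF _ \<open>jump_time n \<tau>\<close> below])
    show "n s = n j" if "s \<in> {\<tau>..j}" for s
      using that above[of s] at\<tau> by (cases "s = \<tau>") auto
  qed
qed

lemma dynamics_constant:
  assumes "meteor_dynamics G n m" "0 \<le> s" "s \<le> t"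
    and "\<And>u v. u \<in> {s<..t} \<Longrightarrow> v = x \<or> (v, x) \<in> parcs G \<Longrightarrow> \<not> jump_time (n v) u"
  shows "m t $ x = m s $ x"
  using assms unfolding meteor_dynamics_def by blast

lemma dynamics_jump_site: "meteor_dynamics G n m \<Longrightarrow> jump_time (n v) t \<Longrightarrow> m t $ v = 0"
  unfolding meteor_dynamics_def by blast

text \<open>
  The time \<open>\<tau>\<close> of the only jump in the interval does not matter: the state is constant before and
  after \<open>\<tau>\<close>, so its left limit at \<open>\<tau>\<close> is the state at \<open>i\<close>.
\<close>
lemma dynamics_single_hit:
  assumes dyn: "meteor_dynamics G n m" and n: "\<And>v. counting_path (n v)"
    and i: "0 \<le> i" "i < j" and v: "n v j = Suc (n v i)" and others: "\<And>u. u \<noteq> v \<Longrightarrow> n u j = n u i"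
    and deg: "degree G v = card (parcs G `` {v})" and loop: "(v, v) \<notin> parcs G"
  shows "m j = hit (parcs G) v (m i)"
proof -
  have "n v i < n v j" using v by simp
  then obtain \<tau> where \<tau>: "\<tau> \<in> {i<..j}" "jump_time (n v) \<tau>" and below: "\<And>s. s \<in> {i..<\<tau>} \<Longrightarrow> n v s < n v j"
    and above: "\<And>s. s \<in> {\<tau>..j} \<Longrightarrow> n v s = n v j"
    by (rule last_jump[OF n i(1) less_imp_le[OF i(2)]]) (rule that)
  have quiet: "\<not> jump_time (n u) r" if "u \<noteq> v" "r \<in> {i<..j}" for u r
    using no_jump_if_constant[OF n i(1) others[symmetric]] that by simp
  have before: "\<not> jump_time (n u) r" if "r \<in> {i<..<\<tau>}" for u r
  proof (cases "u = v")
    case True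
    have "n v r = n v i"
      using below[of r] counting_path_mono[OF n, of i r v] that i v by simp
    then show ?thesis using no_jump_if_constant[OF n i(1), of v r r] that True by simp
  next
    case False
    then show ?thesis using quiet that \<tau>(1) by simp
  qed
  have after: "\<not> jump_time (n u) r" if "r \<in> {\<tau><..j}" for u r
  proof (cases "u = v")
    case True
    then show ?thesis
      using no_jump_if_constant[OF n, of \<tau> u j r] above[of \<tau>] that \<tau>(1) i by simp
  next
    case False
    then show ?thesis using quiet that \<tau>(1) by simp
  qed
  have still: "m s = m i" if "s \<in> {i..<\<tau>}" for s
  proof (unfold vec_eq_iff, rule allI)
    fix x
    show "m s $ x = m i $ x"
      by (rule dynamics_constant[OF dyn i(1)]) (use that in simp, rule before, use that in simp)
  qed
  have left: "left_limit m \<tau> = m i"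
    by (rule left_limit_eqI[of i]) (use \<tau>(1) in simp, rule still, simp)
  have "m \<tau> $ x = hit (parcs G) v (m i) $ x" for x
  proof -
    consider "x = v" | "(v, x) \<in> parcs G" | "x \<noteq> v" "(v, x) \<notin> parcs G" by blast
    then show ?thesis
    proof cases
      case 1
      then show ?thesis using dynamics_jump_site[OF dyn \<tau>(2)] loop by (simp add: hit_def)
    next
      case 2
      then have "x \<noteq> v" using loop by auto
      moreover have "m \<tau> $ x = left_limit m \<tau> $ x + left_limit m \<tau> $ v / real (degree G v)"
        using dyn \<tau>(2) 2 unfolding meteor_dynamics_def by blast
      ultimately show ?thesis using 2 by (simp add: hit_def left deg)
    next
      case 3
      have "m \<tau> $ x = m i $ x"
      proof (rule dynamics_constant[OF dyn i(1)])
        show "i \<le> \<tau>" using \<tau>(1) by simp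
        fix r u assume "r \<in> {i<..\<tau>}" "u = x \<or> (u, x) \<in> parcs G"
        then show "\<not> jump_time (n u) r" using 3 \<tau>(1) by (intro quiet) auto
      qed
      then show ?thesis using 3 by (simp add: hit_def)
    qed
  qed
  moreover have "m j $ x = m \<tau> $ x" for x
    using after \<tau>(1) i by (intro dynamics_constant[OF dyn]) auto
  ultimately show ?thesis by (simp add: vec_eq_iff)
qed

text \<open>Here \<open>w\<close> lists the hits in chronological order, hence the reversal.\<close>
lemma dynamics_run:
  assumes dyn: "meteor_dynamics G n m" and n: "\<And>v. counting_path (n v)"
    and hits: "\<And>l v. l < length w \<Longrightarrow> n v (real (Suc l)) - n v (real l) = (if v = w ! l then 1 else 0)"
    and deg: "\<And>v. degree G v = card (parcs G `` {v})" and loop: "\<And>v. (v, v) \<notin> parcs G"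
  shows "m (real (length w)) = run (parcs G) (rev w) (m 0)"
proof -
  have "m (real l) = run (parcs G) (rev (take l w)) (m 0)" if "l \<le> length w" for l
    using that
  proof (induction l)
    case (Suc l)
    then have l: "l < length w" by simp
    have inc: "n v (real (Suc l)) = n v (real l) + (if v = w ! l then 1 else 0)" for v
      using hits[OF l, of v] counting_path_mono[OF n, of "real l" "real (Suc l)" v] by simp
    have "m (real (Suc l)) = hit (parcs G) (w ! l) (m (real l))"
      using inc[of "w ! l"] by (intro dynamics_single_hit[OF dyn n]) (simp_all add: inc deg loop del: of_nat_Suc)
    then show ?case using Suc l by (simp add: take_Suc_conv_app_nth)
  qed simp
  from this[of "length w"] show ?thesis by simp
qed

text \<open>The vertex that was hit last is still empty.\<close>
lemma dynamics_vacant_site: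
  assumes dyn: "meteor_dynamics G n m" and n: "\<And>v. counting_path (n v)"
    and t: "0 \<le> t" and v: "0 < n v t"
  shows "\<exists>x. m t $ x = 0"
proof -
  define H where "H = {v. 0 < n v t}"
  have "\<exists>\<tau>. \<tau> \<in> {0<..t} \<and> jump_time (n u) \<tau> \<and> n u \<tau> = n u t" if "u \<in> H" for u
  proof -
    have "n u 0 < n u t" using that n[of u] by (simp add: H_def counting_path_def)
    then obtain \<tau> where \<tau>: "\<tau> \<in> {0<..t}" "jump_time (n u) \<tau>" "\<And>s. s \<in> {\<tau>..t} \<Longrightarrow> n u s = n u t"
      by (rule last_jump[OF n order_refl t]) (rule that)
    show ?thesis
    proof (intro exI conjI)
      show "n u \<tau> = n u t" by (rule \<tau>(3)) (use \<tau>(1) in simp)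
    qed (fact \<tau>)+
  qed
  then have "\<exists>\<tau>. \<forall>u\<in>H. \<tau> u \<in> {0<..t} \<and> jump_time (n u) (\<tau> u) \<and> n u (\<tau> u) = n u t"
    by (rule bchoice[OF ballI])
  then obtain \<tau> where \<tau>: "\<And>u. u \<in> H \<Longrightarrow> \<tau> u \<in> {0<..t}" "\<And>u. u \<in> H \<Longrightarrow> jump_time (n u) (\<tau> u)"
    "\<And>u. u \<in> H \<Longrightarrow> n u (\<tau> u) = n u t"
    by blast
  have H: "H \<noteq> {}" using v by (auto simp: H_def)
  have "Max (\<tau> ` H) \<in> \<tau> ` H" using H by (intro Max_in) auto
  then obtain x where x: "x \<in> H" "\<tau> x = Max (\<tau> ` H)" by (metis imageE)
  have max: "\<tau> u \<le> \<tau> x" if "u \<in> H" for u unfolding x(2) using that by simp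
  have "\<not> jump_time (n u) r" if r: "r \<in> {\<tau> x<..t}" for u r
  proof (cases "u \<in> H")
    case True
    then show ?thesis
      using no_jump_if_constant[OF n, of "\<tau> u" u t r] \<tau>[OF True] max[OF True] r by simp
  next
    case False
    then show ?thesis
      using no_jump_if_constant[OF n, of 0 u t r] n[of u] \<tau>(1)[OF x(1)] r by (simp add: H_def counting_path_def)
  qed
  then have "m t $ x = m (\<tau> x) $ x"
    using \<tau>(1)[OF x(1)] by (intro dynamics_constant[OF dyn]) auto
  also have "\<dots> = 0" by (rule dynamics_jump_site[OF dyn \<tau>(2)[OF x(1)]])
  finally show ?thesis by blast
qed

section \<open>Probabilities of hit sequences\<close>

lemma path_increment_event:
  "{p \<in> space path_space. \<forall>l<n. p (real (Suc l)) - p (real l) = c l} \<in> sets path_space"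
proof -
  have [measurable]: "(\<lambda>p. p t) \<in> path_space \<rightarrow>\<^sub>M count_space UNIV" if "0 \<le> t" for t :: real
    using that by (intro measurable_component_singleton) simp
  show ?thesis by measurable
qed

lemma poisson_process_increments_prob:
  assumes "prob_space P" and N: "poisson_process P 1 N"
  shows "0 < measure P {\<omega> \<in> space P. \<forall>l<n. N (real (Suc l)) \<omega> - N (real l) \<omega> = c l}"
proof -
  interpret prob_space P by fact
  define X where "X l \<omega> = N (real (Suc l)) \<omega> - N (real l) \<omega>" for l \<omega>
  have [measurable]: "N t \<in> P \<rightarrow>\<^sub>M count_space UNIV" if "0 \<le> t" for t
    using N that unfolding poisson_process_def by blast
  have X_meas [measurable]: "X l \<in> P \<rightarrow>\<^sub>M count_space UNIV" for l
    unfolding X_def by measurable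
  have "\<forall>(n::nat) \<tau>. 0 \<le> \<tau> 0 \<longrightarrow> mono \<tau> \<longrightarrow>
      indep_vars (\<lambda>_. count_space UNIV) (\<lambda>i \<omega>. N (\<tau> (Suc i)) \<omega> - N (\<tau> i) \<omega>) {..<n}"
    using N unfolding poisson_process_def by blast
  from this[rule_format, of real n]
  have indep: "indep_vars (\<lambda>_. count_space UNIV) X {..<n}"
    by (simp add: X_def[abs_def] mono_def del: of_nat_Suc)
  have pos: "0 < prob (X l -` {c l} \<inter> space P)" for l
  proof -
    have "distr P (count_space UNIV) (X l) = measure_pmf (poisson_pmf (1 * (real (Suc l) - real l)))"
      using N unfolding poisson_process_def X_def by auto
    then have "distr P (count_space UNIV) (X l) = measure_pmf (poisson_pmf 1)" by simp
    then have "prob (X l -` {c l} \<inter> space P) = measure (measure_pmf (poisson_pmf 1)) {c l}"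
      using measure_distr[OF X_meas, of "{c l}" l] by simp
    then show ?thesis by (simp add: measure_pmf_single)
  qed
  have ev: "{\<omega> \<in> space P. \<forall>l<n. N (real (Suc l)) \<omega> - N (real l) \<omega> = c l} =
      (\<Inter>l\<in>{..<n}. X l -` {c l} \<inter> space P) \<inter> space P"
    by (auto simp: X_def)
  show ?thesis
  proof (cases "n = 0")
    case True
    then show ?thesis by (simp add: prob_space)
  next
    case False
    then have ne: "{..<n} \<noteq> {}" by auto
    have "(\<Inter>l\<in>{..<n}. X l -` {c l} \<inter> space P) \<inter> space P = (\<Inter>l\<in>{..<n}. X l -` {c l} \<inter> space P)"
      using ne by blast
    then show ?thesis
      unfolding ev using indep_varsD_finite[OF indep ne, of "\<lambda>l. {c l}"] pos
      by (simp add: prod_pos)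
  qed
qed

context
  fixes P :: "'w measure" and G :: "'v::finite pair_pre_digraph"
    and N :: "'v \<Rightarrow> real \<Rightarrow> 'w \<Rightarrow> nat" and M :: "real \<Rightarrow> 'w \<Rightarrow> real ^ 'v"
  assumes process: "meteor_process P G N M"
    and degree_card: "\<And>v. degree G v = card (parcs G `` {v})" and no_loops: "\<And>v. (v, v) \<notin> parcs G"
begin

interpretation prob_space P
  using process unfolding meteor_process_def by blast

lemma meteor_poisson: "poisson_process P 1 (N v)"
  using process unfolding meteor_process_def by blast

lemma meteor_mass_measurable [measurable]: "0 \<le> t \<Longrightarrow> M t \<in> borel_measurable P"
  using process unfolding meteor_process_def by blast

lemma meteor_clock_measurable [measurable]: "0 \<le> t \<Longrightarrow> N v t \<in> P \<rightarrow>\<^sub>M count_space UNIV"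
  using meteor_poisson[of v] unfolding poisson_process_def by blast

lemma meteor_paths:
  "AE \<omega> in P. meteor_dynamics G (\<lambda>v t. N v t \<omega>) (\<lambda>t. M t \<omega>) \<and> (\<forall>v. counting_path (\<lambda>t. N v t \<omega>))"
proof -
  have "AE \<omega> in P. counting_path (\<lambda>t. N v t \<omega>)" for v
    using meteor_poisson[of v] unfolding poisson_process_def counting_path_def by blast
  moreover have "AE \<omega> in P. meteor_dynamics G (\<lambda>v t. N v t \<omega>) (\<lambda>t. M t \<omega>)"
    using process unfolding meteor_process_def by blast
  ultimately show ?thesis by (simp add: AE_all_countable)
qed

text \<open>
  The event \<open>H v\<close> below prescribes the increments of the clock at \<open>v\<close> over the first unit intervals:
  one jump in the \<open>l\<close>-th interval if \<open>v\<close> is the \<open>l\<close>-th letter of \<open>w\<close>, and none otherwise.  These events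
  have positive probability, are independent of each other and of the initial state, and together
  they force the sequence of hits to be \<open>w\<close>.
\<close>
lemma hit_sequence_prob:
  assumes B: "B \<in> sets borel" and pos: "0 < prob {\<omega> \<in> space P. run (parcs G) (rev w) (M 0 \<omega>) \<in> B}"
  shows "0 < prob {\<omega> \<in> space P. M (real (length w)) \<omega> \<in> B}"
proof -
  define n where "n = length w"
  define c where "c v l = (if v = w ! l then 1 else (0::nat))" for v l
  define A where "A v = {p \<in> space path_space. \<forall>l<n. p (real (Suc l)) - p (real l) = c v l}" for v
  have A: "A v \<in> sets path_space" for v unfolding A_def by (rule path_increment_event)
  define H where "H v = path (N v) -` A v \<inter> space P" for v
  have H_eq: "H v = {\<omega> \<in> space P. \<forall>l<n. N v (real (Suc l)) \<omega> - N v (real l) \<omega> = c v l}" for v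
    by (auto simp: H_def A_def path_def space_PiM)
  have H_pos: "0 < prob (H v)" for v
    unfolding H_eq by (rule poisson_process_increments_prob[OF prob_space_axioms meteor_poisson])
  have H_sets [measurable]: "H v \<in> sets P" for v
    unfolding H_eq by measurable
  have "indep_vars (\<lambda>_. path_space) (\<lambda>v. path (N v)) UNIV"
    using process unfolding meteor_process_def by blast
  from indep_varsD_finite[OF this _ _ A]
  have "prob (\<Inter>v. H v) = (\<Prod>v\<in>UNIV. prob (H v))" by (simp add: H_def)
  then have HH_pos: "0 < prob (\<Inter>v. H v)" using H_pos by (simp add: prod_pos)
  define I where "I = {\<omega> \<in> space P. run (parcs G) (rev w) (M 0 \<omega>) \<in> B}"
  have run_meas: "run (parcs G) (rev w) \<in> borel_measurable borel"
    by (intro borel_measurable_continuous_onI linear_continuous_on linear_conv_bounded_linear[THEN iffD1] linear_run)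
  have I_in: "I \<in> sets (vimage_algebra (space P) (M 0) borel)"
  proof -
    have "I = M 0 -` (run (parcs G) (rev w) -` B) \<inter> space P" by (auto simp: I_def)
    moreover have "run (parcs G) (rev w) -` B \<in> sets borel"
      using measurable_sets[OF run_meas B] by simp
    ultimately show ?thesis by (simp add: in_vimage_algebra)
  qed
  have H_in: "(\<Inter>v. H v) \<in> sets (vimage_algebra (space P) (\<lambda>\<omega>. \<lambda>v\<in>UNIV. path (N v) \<omega>) (PiM UNIV (\<lambda>_. path_space)))"
  proof -
    have "(\<Inter>v. H v) = (\<lambda>\<omega>. \<lambda>v\<in>UNIV. path (N v) \<omega>) -` (Pi\<^sub>E UNIV A) \<inter> space P"
      by (auto simp: H_def)
    moreover have "Pi\<^sub>E UNIV A \<in> sets (PiM UNIV (\<lambda>_. path_space))"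
      using A by (intro sets_PiM_I_finite) auto
    ultimately show ?thesis by (simp add: in_vimage_algebra)
  qed
  have "indep_set (sets (vimage_algebra (space P) (M 0) borel))
       (sets (vimage_algebra (space P) (\<lambda>\<omega>. \<lambda>v\<in>UNIV. path (N v) \<omega>) (PiM UNIV (\<lambda>_. path_space))))"
    using process unfolding meteor_process_def by blast
  from indep_setD[OF this I_in H_in]
  have "0 < prob (I \<inter> (\<Inter>v. H v))" using pos HH_pos by (simp add: I_def)
  also have "prob (I \<inter> (\<Inter>v. H v)) \<le> prob {\<omega> \<in> space P. M (real n) \<omega> \<in> B}"
  proof (rule finite_measure_mono_AE)
    show "AE \<omega> in P. \<omega> \<in> I \<inter> (\<Inter>v. H v) \<longrightarrow> \<omega> \<in> {\<omega> \<in> space P. M (real n) \<omega> \<in> B}"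
      using meteor_paths
    proof eventually_elim
      case (elim \<omega>)
      show ?case
      proof
        assume \<omega>: "\<omega> \<in> I \<inter> (\<Inter>v. H v)"
        have "M (real (length w)) \<omega> = run (parcs G) (rev w) (M 0 \<omega>)"
        proof (rule dynamics_run[where n = "\<lambda>v t. N v t \<omega>"])
          fix l v assume "l < length w"
          then show "N v (real (Suc l)) \<omega> - N v (real l) \<omega> = (if v = w ! l then 1 else 0)"
            using \<omega> by (simp add: H_eq n_def c_def)
        qed (use elim degree_card no_loops in blast)+
        then show "\<omega> \<in> {\<omega> \<in> space P. M (real n) \<omega> \<in> B}"
          using \<omega> by (simp add: I_def n_def)
      qed
    qed
    show "{\<omega> \<in> space P. M (real n) \<omega> \<in> B} \<in> sets P"
      using measurable_sets[OF meteor_mass_measurable B, of "real n"]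
      by (simp add: vimage_def Int_def conj_commute)
  qed
  finally show ?thesis by (simp add: n_def)
qed

text \<open>By \<open>dynamics_vacant_site\<close>, the event requires that a given clock, say the one at \<open>v\<close>, has not rung.\<close>
lemma no_vacant_site_prob:
  assumes "0 < t"
  shows "prob {\<omega> \<in> space P. \<forall>x. M t \<omega> $ x \<noteq> 0} \<le> exp (- t)"
proof -
  fix v
  define X where "X \<omega> = N v t \<omega> - N v 0 \<omega>" for \<omega>
  have [measurable]: "N v t \<in> P \<rightarrow>\<^sub>M count_space UNIV" using assms by (intro meteor_clock_measurable) simp
  have X [measurable]: "X \<in> P \<rightarrow>\<^sub>M count_space UNIV" unfolding X_def by measurable
  have "distr P (count_space UNIV) X = measure_pmf (poisson_pmf (1 * (t - 0)))"
    using meteor_poisson[of v] assms unfolding poisson_process_def X_def by blast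
  then have "prob (X -` {0} \<inter> space P) = measure (measure_pmf (poisson_pmf t)) {0}"
    using measure_distr[OF X, of "{0}"] by simp
  also have "\<dots> = exp (- t)" using assms by (simp add: measure_pmf_single)
  finally have X0: "prob (X -` {0} \<inter> space P) = exp (- t)" .
  have "prob {\<omega> \<in> space P. \<forall>x. M t \<omega> $ x \<noteq> 0} \<le> prob (X -` {0} \<inter> space P)"
  proof (rule finite_measure_mono_AE)
    show "AE \<omega> in P. \<omega> \<in> {\<omega> \<in> space P. \<forall>x. M t \<omega> $ x \<noteq> 0} \<longrightarrow> \<omega> \<in> X -` {0} \<inter> space P"
      using meteor_paths
    proof eventually_elim
      case (elim \<omega>)
      then have dyn: "meteor_dynamics G (\<lambda>v t. N v t \<omega>) (\<lambda>t. M t \<omega>)"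
        and n: "\<And>v. counting_path (\<lambda>t. N v t \<omega>)" by blast+
      show ?case
      proof
        assume \<omega>: "\<omega> \<in> {\<omega> \<in> space P. \<forall>x. M t \<omega> $ x \<noteq> 0}"
        then have "\<not> 0 < N v t \<omega>"
          using dynamics_vacant_site[OF dyn n, of t v] assms by auto
        then show "\<omega> \<in> X -` {0} \<inter> space P" using \<omega> by (simp add: X_def)
      qed
    qed
    show "X -` {0} \<inter> space P \<in> sets P" using measurable_sets[OF X, of "{0}"] by simp
  qed
  then show ?thesis by (simp add: X0)
qed

section \<open>The support of the stationary measure\<close>

text \<open>Stationarity allows to let \<open>t\<close> tend to infinity in \<open>no_vacant_site_prob\<close>.\<close>
lemma stationary_vacant_site:
  assumes "\<And>t. 0 \<le> t \<Longrightarrow> distr P borel (M t) = Q"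
  shows "AE a in Q. \<exists>x. a $ x = 0"
proof -
  define Z where "Z = {a :: real ^ 'v. \<forall>x. a $ x \<noteq> 0}"
  have Z: "Z \<in> sets borel" unfolding Z_def by measurable
  have Q: "Q = distr P borel (M 0)" using assms[of 0] by simp
  have "emeasure Q Z \<le> ennreal (exp (- t))" if "0 < t" for t
  proof -
    have "emeasure Q Z = emeasure P (M t -` Z \<inter> space P)"
      using emeasure_distr[OF meteor_mass_measurable Z, of t] assms[of t] that by simp
    also have "M t -` Z \<inter> space P = {\<omega> \<in> space P. \<forall>x. M t \<omega> $ x \<noteq> 0}" by (auto simp: Z_def)
    also have "emeasure P \<dots> \<le> ennreal (exp (- t))"
      using no_vacant_site_prob[OF that] by (simp add: emeasure_eq_measure)
    finally show ?thesis .
  qed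
  moreover have "((\<lambda>t. ennreal (exp (- t))) \<longlongrightarrow> ennreal 0) at_top"
    by (intro tendsto_ennrealI filterlim_compose[OF exp_at_bot] filterlim_uminus_at_bot_at_top)
  ultimately have "emeasure Q Z \<le> ennreal 0"
    by (intro tendsto_lowerbound[of _ "ennreal 0" at_top "emeasure Q Z"])
      (auto intro: eventually_mono[OF eventually_gt_at_top[of 0]])
  then have "Z \<in> null_sets Q" using Z by (auto simp: null_sets_def Q)
  then show ?thesis by (rule AE_I'[of Z]) (auto simp: Z_def)
qed

text \<open>
  One of the countably many sets of states that a fixed word moves into \<open>B\<close> has positive measure.
  Start there, and let the clocks produce that word.
\<close>
lemma stationary_support_run:
  assumes Q: "\<And>t. 0 \<le> t \<Longrightarrow> distr P borel (M t) = Q" and B: "B \<in> sets borel"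
    and reach: "AE a in Q. \<exists>w. run (parcs G) w a \<in> B"
  shows "0 < emeasure Q B"
proof -
  have law: "emeasure Q A = emeasure P {\<omega> \<in> space P. M t \<omega> \<in> A}" if "0 \<le> t" "A \<in> sets borel" for t A
    using emeasure_distr[OF meteor_mass_measurable[OF that(1)] that(2)] Q[OF that(1)]
    by (simp add: vimage_def Int_def conj_commute)
  have Q0: "Q = distr P borel (M 0)" using Q[of 0] by simp
  define D where "D w = {a. run (parcs G) w a \<in> B}" for w
  have D: "D w \<in> sets borel" for w
  proof -
    have "run (parcs G) w \<in> borel_measurable borel"
      by (intro borel_measurable_continuous_onI linear_continuous_on linear_conv_bounded_linear[THEN iffD1] linear_run)
    from measurable_sets[OF this B] show ?thesis by (simp add: D_def vimage_def)
  qed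
  have "\<exists>w. 0 < emeasure Q (D w)"
  proof (rule ccontr)
    assume "\<not> (\<exists>w. 0 < emeasure Q (D w))"
    then have "D w \<in> null_sets Q" for w using D by (auto simp: null_sets_def Q0)
    then have "(\<Union>w. D w) \<in> null_sets Q" by (rule null_sets_UN)
    then have "AE a in Q. a \<notin> (\<Union>w. D w)" by (rule AE_not_in)
    with reach have "AE a in Q. False"
      by eventually_elim (auto simp: D_def)
    moreover have "prob_space Q" unfolding Q0 by (rule prob_space_distr) simp
    ultimately show False by (simp add: prob_space.AE_False)
  qed
  then obtain w where w: "0 < emeasure Q (D w)" by blast
  have "0 < prob {\<omega> \<in> space P. run (parcs G) (rev (rev w)) (M 0 \<omega>) \<in> B}"
    using w law[OF order_refl D, of w] by (simp add: D_def emeasure_eq_measure)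
  from hit_sequence_prob[OF B this]
  have "0 < prob {\<omega> \<in> space P. M (real (length w)) \<omega> \<in> B}" by simp
  then show ?thesis
    using law[OF _ B, of "real (length w)"] by (simp add: emeasure_eq_measure)
qed

end

lemma pair_graph_meteor_graph:
  assumes "pair_graph G" "pverts G = UNIV" "Digraph_Component.connected (with_proj G)"
    and "\<forall>v. degree G v \<ge> 1"
  shows "meteor_graph (parcs G)" "degree G v = card (parcs G `` {v})"
proof -
  interpret pair_graph G by fact
  have "out_arcs (with_proj G) u = Pair u ` (parcs G `` {u})" for u
    by (auto simp: out_arcs_def)
  then have deg: "degree G u = card (parcs G `` {u})" for u
    by (simp add: out_degree_def card_image inj_on_def)
  then show "degree G v = card (parcs G `` {v})" .
  have sym: "sym (parcs G)"
    using pair_sym_arcs by (simp add: symmetric_def)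
  show "meteor_graph (parcs G)"
  proof
    show "(y, x) \<in> parcs G" if "(x, y) \<in> parcs G" for x y using sym that by (rule symD)
    show "(x, x) \<notin> parcs G" for x using pair_no_loops[of "(x, x)"] by auto
    show "\<exists>y. (x, y) \<in> parcs G" for x
      using assms(4)[rule_format, of x] unfolding deg
      by (metis Image_singleton_iff card.empty empty_iff not_one_le_zero subsetI subset_antisym)
    fix x y
    have arcs: "parcs (mk_symmetric (with_proj G)) = parcs G"
      using sym by (auto simp: parcs_mk_symmetric dest: symD)
    have "x \<rightarrow>\<^sup>*\<^bsub>with_proj (mk_symmetric (with_proj G))\<^esub> y"
      using assms(2,3) unfolding Digraph_Component.connected_def strongly_connected_def by simp
    then have "(x, y) \<in> (arcs_ends (with_proj (mk_symmetric (with_proj G))))\<^sup>*"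
      by (rule reachable_rtranclI)
    then show "(x, y) \<in> (parcs G)\<^sup>*" by (simp add: arcs)
  qed
qed

theorem theorem6p1:
  fixes G :: "'v::finite pair_pre_digraph"
    and P :: "'w measure"
    and N :: "'v \<Rightarrow> real \<Rightarrow> 'w \<Rightarrow> nat"
    and M :: "real \<Rightarrow> 'w \<Rightarrow> real ^ 'v"
    and Q :: "(real ^ 'v) measure"
  assumes "pair_graph G"
    and "pverts G = UNIV"
    and "Digraph_Component.connected (with_proj G)"
    and "\<forall>v. degree G v \<ge> 1"
    and "stationary_measure P G N M Q"
    and "AE a in Q. (\<Sum>x\<in>UNIV. a $ x) = real CARD('v)"
  shows "closure (measure_support Q) =
         {a. (\<forall>x. 0 \<le> a $ x) \<and> (\<Sum>x\<in>UNIV. a $ x) = real CARD('v) \<and> (\<exists>x. a $ x = 0)}"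
proof -
  interpret meteor_graph "parcs G" by (rule pair_graph_meteor_graph) fact+
  have deg_G: "degree G v = card (parcs G `` {v})" for v
    by (rule pair_graph_meteor_graph) fact+
  have process: "meteor_process P G N M" and Q: "\<And>t. 0 \<le> t \<Longrightarrow> distr P borel (M t) = Q"
    using assms(5) unfolding stationary_measure_def by blast+
  define U where "U = {a :: real ^ 'v. (\<forall>x. 0 \<le> a $ x) \<and> (\<Sum>x\<in>UNIV. a $ x) = real CARD('v) \<and> (\<exists>x. a $ x = 0)}"
  have Q0: "Q = distr P borel (M 0)" using Q[of 0] by simp
  have M0: "M 0 \<in> borel_measurable P" using process unfolding meteor_process_def by simp
  have nonneg: "AE a in Q. \<forall>x. 0 \<le> a $ x"
    unfolding Q0 using process unfolding meteor_process_def by (subst AE_distr_iff[OF M0]) auto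
  have vacant: "AE a in Q. \<exists>x. a $ x = 0"
    by (rule stationary_vacant_site[OF process deg_G loopfree Q])
  have "closed U"
  proof -
    have "U = (\<Inter>x. {a. 0 \<le> a $ x}) \<inter> {a. (\<Sum>x\<in>UNIV. a $ x) = real CARD('v)} \<inter> (\<Union>x. {a. a $ x = 0})"
      by (auto simp: U_def)
    also have "closed \<dots>"
      by (intro closed_Int closed_INT closed_UN ballI finite closed_Collect_le closed_Collect_eq continuous_intros)
    finally show ?thesis .
  qed
  moreover have "measure_support Q \<subseteq> U"
  proof
    fix a assume a: "a \<in> measure_support Q"
    have "AE a in Q. a \<notin> - U"
      using nonneg vacant assms(6) by eventually_elim (simp add: U_def)
    moreover have "- U \<in> sets Q" using \<open>closed U\<close> by (simp add: Q0)
    ultimately have "emeasure Q (- U) = 0" using AE_iff_null_sets by blast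
    moreover have "open (- U)" using \<open>closed U\<close> by (simp add: open_Compl)
    ultimately show "a \<in> U" using a unfolding measure_support_def by fastforce
  qed
  moreover have "U \<subseteq> measure_support Q"
  proof
    fix a assume a: "a \<in> U"
    then obtain z where z: "a $ z = 0" by (auto simp: U_def)
    have mass_a: "mass a = real CARD('v)" and pos_a: "\<And>x. 0 \<le> a $ x" using a by (auto simp: U_def mass_def)
    show "a \<in> measure_support Q"
      unfolding measure_support_def
    proof (intro CollectI allI impI)
      fix S assume S: "open S" "a \<in> S"
      then obtain e where e: "0 < e" "\<And>b. dist b a < e \<Longrightarrow> b \<in> S" unfolding open_dist by blast
      have "AE b in Q. \<exists>w. run (parcs G) w b \<in> S"
        using nonneg assms(6)
      proof eventually_elim
        case (elim b)
        have "\<exists>w. norm (run (parcs G) w b - a) < e"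
          by (rule meteor_approximation[of b a z e]) (use elim mass_a pos_a z e(1) in \<open>auto simp: mass_def\<close>)
        then show ?case using e(2) by (auto simp: dist_norm)
      qed
      then show "0 < emeasure Q S"
        using S(1) by (intro stationary_support_run[OF process deg_G loopfree Q]) auto
    qed
  qed
  ultimately have "closure (measure_support Q) = U" by (simp add: closure_closed subset_antisym)
  then show ?thesis by (simp add: U_def)
qed

end
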